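(* Let $\mathcal{A}$ be a regular category. Then $\mathcal{A}$ is an exact arithmetical category if and only if the following condition holds: for every object $X$ and every triple of regular epimorphisms $r_1\colon X\to B_1$, $r_2\colon X\to B_2$, $r_3\colon X\to B_3$ with common domain $X$, the pairwise pushouts $B_i\to D_{ij}\leftarrow B_j$ of $(r_i,r_j)$ exist for all $1\le i<j\le 3$ and, denoting by $L$ the limit of the diagram formed by the six objects $B_1,B_2,B_3,D_{12},D_{13},D_{23}$ and the six pushout coprojections $B_i\to D_{ij}\leftarrow B_j$ ($1\le i<j\le 3$), the canonical comparison morphism $a\colon X\to L$ induced by the cone $(r_1,r_2,r_3)$ is a regular epimorphism.
   Context: All categories are assumed finitely complete. A category is regular if kernel pairs admit coequalizers and regular epimorphisms are stable under pullback. It is (Barr-)exact if it is regular and every internal equivalence relation is effective, i.e. is the kernel pair of some morphism. A Mal'tsev category is a finitely complete category in which every internal reflexive relation $R\rightarrowtail X\times X$ is an equivalence relation. For an object $X$, $\mathrm{Equiv}(X)$ denotes the poset of internal equivalence relations on $X$, ordered by inclusion of subobjects of $X\times X$; in an exact Mal'tsev category it is a lattice (meets are intersections, and the join of $\theta$ and $\varphi$ is the relational composite $\theta\circ\varphi=\varphi\circ\theta$). An (exact) arithmetical category is an exact Mal'tsev category such that the lattice $\mathrm{Equiv}(X)$ is distributive for every object $X$. *)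

theory Defs
  imports Main "HOL-Algebra.Lattice"
begin

section \<open>Categories\<close>

record ('o, 'a) cat_data =
  Obj :: "'o set"
  Arr :: "'a set"
  Dom :: "'a \<Rightarrow> 'o"
  Cod :: "'a \<Rightarrow> 'o"
  Ident :: "'o \<Rightarrow> 'a"
  Comp :: "'a \<Rightarrow> 'a \<Rightarrow> 'a"  (infixl \<open>\<cdot>\<index>\<close> 70)

text \<open>Composition is written in applicative order: \<open>g \<cdot> f\<close> means ``first \<open>f\<close>, then \<open>g\<close>''.
  Its value on non-composable pairs is irrelevant.\<close>

definition Hom :: "('o, 'a) cat_data \<Rightarrow> 'o \<Rightarrow> 'o \<Rightarrow> 'a set" where
  "Hom C X Y = {f \<in> Arr C. Dom C f = X \<and> Cod C f = Y}"

locale category =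
  fixes C :: "('o, 'a) cat_data" (structure)
  assumes Dom_Obj: "f \<in> Arr C \<Longrightarrow> Dom C f \<in> Obj C"
    and Cod_Obj: "f \<in> Arr C \<Longrightarrow> Cod C f \<in> Obj C"
    and Ident_Hom: "X \<in> Obj C \<Longrightarrow> Ident C X \<in> Hom C X X"
    and Comp_Hom: "f \<in> Hom C X Y \<Longrightarrow> g \<in> Hom C Y Z \<Longrightarrow> g \<cdot> f \<in> Hom C X Z"
    and Ident_right: "f \<in> Hom C X Y \<Longrightarrow> f \<cdot> Ident C X = f"
    and Ident_left: "f \<in> Hom C X Y \<Longrightarrow> Ident C Y \<cdot> f = f"
    and Comp_assoc: "f \<in> Hom C W X \<Longrightarrow> g \<in> Hom C X Y \<Longrightarrow> h \<in> Hom C Y Z \<Longrightarrow>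
      (h \<cdot> g) \<cdot> f = h \<cdot> (g \<cdot> f)"


section \<open>Limits and colimits\<close>

text \<open>A diagram is indexed by a directed graph. A functor has the same limits as its underlying
  graph diagram, and having limits of all finite graph diagrams is the same as having limits
  of all finite categories (both amount to finite products and equalizers).\<close>

record ('v, 'e, 'o, 'a) diagram =
  Vert :: "'v set"
  Edge :: "'e set"
  src :: "'e \<Rightarrow> 'v"
  tgt :: "'e \<Rightarrow> 'v"
  Dob :: "'v \<Rightarrow> 'o"
  Dar :: "'e \<Rightarrow> 'a"

definition is_diagram :: "('o, 'a) cat_data \<Rightarrow> ('v, 'e, 'o, 'a) diagram \<Rightarrow> bool" where
  "is_diagram C D \<longleftrightarrow>
     (\<forall>v\<in>Vert D. Dob D v \<in> Obj C) \<and>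
     (\<forall>e\<in>Edge D. src D e \<in> Vert D \<and> tgt D e \<in> Vert D \<and>
        Dar D e \<in> Hom C (Dob D (src D e)) (Dob D (tgt D e)))"

definition is_cone ::
    "('o, 'a) cat_data \<Rightarrow> ('v, 'e, 'o, 'a) diagram \<Rightarrow> 'o \<Rightarrow> ('v \<Rightarrow> 'a) \<Rightarrow> bool" where
  "is_cone C D X \<mu> \<longleftrightarrow> X \<in> Obj C \<and>
     (\<forall>v\<in>Vert D. \<mu> v \<in> Hom C X (Dob D v)) \<and>
     (\<forall>e\<in>Edge D. Dar D e \<cdot>\<^bsub>C\<^esub> \<mu> (src D e) = \<mu> (tgt D e))"

definition is_limit ::
    "('o, 'a) cat_data \<Rightarrow> ('v, 'e, 'o, 'a) diagram \<Rightarrow> 'o \<Rightarrow> ('v \<Rightarrow> 'a) \<Rightarrow> bool" where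
  "is_limit C D L \<pi> \<longleftrightarrow> is_cone C D L \<pi> \<and>
     (\<forall>X \<mu>. is_cone C D X \<mu> \<longrightarrow>
        (\<exists>!h. h \<in> Hom C X L \<and> (\<forall>v\<in>Vert D. \<pi> v \<cdot>\<^bsub>C\<^esub> h = \<mu> v)))"

text \<open>Every finite graph is isomorphic to one whose vertices and edges are natural numbers.\<close>

definition finitely_complete :: "('o, 'a) cat_data \<Rightarrow> bool" where
  "finitely_complete C \<longleftrightarrow> category C \<and>
     (\<forall>D :: (nat, nat, 'o, 'a) diagram.
        is_diagram C D \<and> finite (Vert D) \<and> finite (Edge D) \<longrightarrow> (\<exists>L \<pi>. is_limit C D L \<pi>))"

definition is_product ::
    "('o, 'a) cat_data \<Rightarrow> 'o \<Rightarrow> 'o \<Rightarrow> 'a \<Rightarrow> 'a \<Rightarrow> bool" where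
  "is_product C X Y p q \<longleftrightarrow>
     p \<in> Hom C (Dom C p) X \<and> q \<in> Hom C (Dom C p) Y \<and>
     (\<forall>T\<in>Obj C. \<forall>f\<in>Hom C T X. \<forall>g\<in>Hom C T Y.
        \<exists>!h. h \<in> Hom C T (Dom C p) \<and> p \<cdot>\<^bsub>C\<^esub> h = f \<and> q \<cdot>\<^bsub>C\<^esub> h = g)"

definition is_pullback ::
    "('o, 'a) cat_data \<Rightarrow> 'a \<Rightarrow> 'a \<Rightarrow> 'a \<Rightarrow> 'a \<Rightarrow> bool" where
  "is_pullback C f g p q \<longleftrightarrow>
     f \<in> Arr C \<and> g \<in> Arr C \<and> Cod C f = Cod C g \<and>
     p \<in> Hom C (Dom C p) (Dom C f) \<and> q \<in> Hom C (Dom C p) (Dom C g) \<and>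
     f \<cdot>\<^bsub>C\<^esub> p = g \<cdot>\<^bsub>C\<^esub> q \<and>
     (\<forall>T\<in>Obj C. \<forall>u\<in>Hom C T (Dom C f). \<forall>v\<in>Hom C T (Dom C g).
        f \<cdot>\<^bsub>C\<^esub> u = g \<cdot>\<^bsub>C\<^esub> v \<longrightarrow>
        (\<exists>!h. h \<in> Hom C T (Dom C p) \<and> p \<cdot>\<^bsub>C\<^esub> h = u \<and> q \<cdot>\<^bsub>C\<^esub> h = v))"

definition is_pushout ::
    "('o, 'a) cat_data \<Rightarrow> 'a \<Rightarrow> 'a \<Rightarrow> 'a \<Rightarrow> 'a \<Rightarrow> bool" where
  "is_pushout C f g p q \<longleftrightarrow>
     f \<in> Arr C \<and> g \<in> Arr C \<and> Dom C f = Dom C g \<and>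
     p \<in> Hom C (Cod C f) (Cod C p) \<and> q \<in> Hom C (Cod C g) (Cod C p) \<and>
     p \<cdot>\<^bsub>C\<^esub> f = q \<cdot>\<^bsub>C\<^esub> g \<and>
     (\<forall>T\<in>Obj C. \<forall>u\<in>Hom C (Cod C f) T. \<forall>v\<in>Hom C (Cod C g) T.
        u \<cdot>\<^bsub>C\<^esub> f = v \<cdot>\<^bsub>C\<^esub> g \<longrightarrow>
        (\<exists>!h. h \<in> Hom C (Cod C p) T \<and> h \<cdot>\<^bsub>C\<^esub> p = u \<and> h \<cdot>\<^bsub>C\<^esub> q = v))"

definition is_coequalizer :: "('o, 'a) cat_data \<Rightarrow> 'a \<Rightarrow> 'a \<Rightarrow> 'a \<Rightarrow> bool" where
  "is_coequalizer C f g c \<longleftrightarrow>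
     f \<in> Arr C \<and> g \<in> Arr C \<and> Dom C f = Dom C g \<and> Cod C f = Cod C g \<and>
     c \<in> Hom C (Cod C f) (Cod C c) \<and> c \<cdot>\<^bsub>C\<^esub> f = c \<cdot>\<^bsub>C\<^esub> g \<and>
     (\<forall>T\<in>Obj C. \<forall>u\<in>Hom C (Cod C f) T. u \<cdot>\<^bsub>C\<^esub> f = u \<cdot>\<^bsub>C\<^esub> g \<longrightarrow>
        (\<exists>!h. h \<in> Hom C (Cod C c) T \<and> h \<cdot>\<^bsub>C\<^esub> c = u))"

definition is_mono :: "('o, 'a) cat_data \<Rightarrow> 'a \<Rightarrow> bool" where
  "is_mono C m \<longleftrightarrow> m \<in> Arr C \<and>
     (\<forall>T\<in>Obj C. \<forall>u\<in>Hom C T (Dom C m). \<forall>v\<in>Hom C T (Dom C m).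
        m \<cdot>\<^bsub>C\<^esub> u = m \<cdot>\<^bsub>C\<^esub> v \<longrightarrow> u = v)"

definition regular_epi :: "('o, 'a) cat_data \<Rightarrow> 'a \<Rightarrow> bool" where
  "regular_epi C e \<longleftrightarrow> (\<exists>f g. is_coequalizer C f g e)"

definition is_kernel_pair :: "('o, 'a) cat_data \<Rightarrow> 'a \<Rightarrow> 'a \<Rightarrow> 'a \<Rightarrow> bool" where
  "is_kernel_pair C f p q \<longleftrightarrow> is_pullback C f f p q"

definition regular_category :: "('o, 'a) cat_data \<Rightarrow> bool" where
  "regular_category C \<longleftrightarrow> finitely_complete C \<and>
     (\<forall>f p q. is_kernel_pair C f p q \<longrightarrow> (\<exists>c. is_coequalizer C p q c)) \<and>
     (\<forall>f g p q. is_pullback C f g p q \<and> regular_epi C f \<longrightarrow> regular_epi C q)"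


section \<open>Internal relations\<close>

text \<open>A chosen product \<open>X \<times> X\<close>, given by its two projections.\<close>

definition square_proj :: "('o, 'a) cat_data \<Rightarrow> 'o \<Rightarrow> 'a \<times> 'a" where
  "square_proj C X = (SOME pq. is_product C X X (fst pq) (snd pq))"

definition square :: "('o, 'a) cat_data \<Rightarrow> 'o \<Rightarrow> 'o" where
  "square C X = Dom C (fst (square_proj C X))"

definition internal_relation :: "('o, 'a) cat_data \<Rightarrow> 'o \<Rightarrow> 'a \<Rightarrow> bool" where
  "internal_relation C X m \<longleftrightarrow> X \<in> Obj C \<and> is_mono C m \<and> Cod C m = square C X"

definition leg0 :: "('o, 'a) cat_data \<Rightarrow> 'o \<Rightarrow> 'a \<Rightarrow> 'a" where
  "leg0 C X m = fst (square_proj C X) \<cdot>\<^bsub>C\<^esub> m"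

definition leg1 :: "('o, 'a) cat_data \<Rightarrow> 'o \<Rightarrow> 'a \<Rightarrow> 'a" where
  "leg1 C X m = snd (square_proj C X) \<cdot>\<^bsub>C\<^esub> m"

definition internal_reflexive :: "('o, 'a) cat_data \<Rightarrow> 'o \<Rightarrow> 'a \<Rightarrow> bool" where
  "internal_reflexive C X m \<longleftrightarrow>
     (\<exists>s\<in>Hom C X (Dom C m).
        leg0 C X m \<cdot>\<^bsub>C\<^esub> s = Ident C X \<and> leg1 C X m \<cdot>\<^bsub>C\<^esub> s = Ident C X)"

definition internal_symmetric :: "('o, 'a) cat_data \<Rightarrow> 'o \<Rightarrow> 'a \<Rightarrow> bool" where
  "internal_symmetric C X m \<longleftrightarrow>
     (\<exists>s\<in>Hom C (Dom C m) (Dom C m).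
        leg0 C X m \<cdot>\<^bsub>C\<^esub> s = leg1 C X m \<and> leg1 C X m \<cdot>\<^bsub>C\<^esub> s = leg0 C X m)"

text \<open>The pullback of \<open>leg1\<close> along \<open>leg0\<close> is the object of composable pairs
  \<open>x R y R z\<close>.\<close>

definition internal_transitive :: "('o, 'a) cat_data \<Rightarrow> 'o \<Rightarrow> 'a \<Rightarrow> bool" where
  "internal_transitive C X m \<longleftrightarrow>
     (\<forall>p q. is_pullback C (leg1 C X m) (leg0 C X m) p q \<longrightarrow>
        (\<exists>t\<in>Hom C (Dom C p) (Dom C m).
           leg0 C X m \<cdot>\<^bsub>C\<^esub> t = leg0 C X m \<cdot>\<^bsub>C\<^esub> p \<and>
           leg1 C X m \<cdot>\<^bsub>C\<^esub> t = leg1 C X m \<cdot>\<^bsub>C\<^esub> q))"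

definition internal_equivalence :: "('o, 'a) cat_data \<Rightarrow> 'o \<Rightarrow> 'a \<Rightarrow> bool" where
  "internal_equivalence C X m \<longleftrightarrow> internal_relation C X m \<and>
     internal_reflexive C X m \<and> internal_symmetric C X m \<and> internal_transitive C X m"

definition effective :: "('o, 'a) cat_data \<Rightarrow> 'o \<Rightarrow> 'a \<Rightarrow> bool" where
  "effective C X m \<longleftrightarrow> (\<exists>f. is_kernel_pair C f (leg0 C X m) (leg1 C X m))"

definition exact_category :: "('o, 'a) cat_data \<Rightarrow> bool" where
  "exact_category C \<longleftrightarrow> regular_category C \<and>
     (\<forall>X m. internal_equivalence C X m \<longrightarrow> effective C X m)"

definition maltsev_category :: "('o, 'a) cat_data \<Rightarrow> bool" where
  "maltsev_category C \<longleftrightarrow> finitely_complete C \<and>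
     (\<forall>X m. internal_relation C X m \<and> internal_reflexive C X m \<longrightarrow>
        internal_equivalence C X m)"


section \<open>Arithmetical categories\<close>

definition subobject_le :: "('o, 'a) cat_data \<Rightarrow> 'a \<Rightarrow> 'a \<Rightarrow> bool" where
  "subobject_le C m n \<longleftrightarrow> (\<exists>h\<in>Hom C (Dom C m) (Dom C n). n \<cdot>\<^bsub>C\<^esub> h = m)"

text \<open>A subobject is a monomorphism up to mutual factorization. Instead of passing to
  equivalence classes, this identification is the equality \<open>.=\<close> of the order structure.\<close>

definition Equiv :: "('o, 'a) cat_data \<Rightarrow> 'o \<Rightarrow> 'a gorder" where
  "Equiv C X =
     \<lparr> carrier = {m. internal_equivalence C X m},
       eq = (\<lambda>m n. subobject_le C m n \<and> subobject_le C n m),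
       le = subobject_le C \<rparr>"

definition distributive_lattice :: "('b, 'm) gorder_scheme \<Rightarrow> bool" where
  "distributive_lattice L \<longleftrightarrow> weak_lattice L \<and>
     (\<forall>x\<in>carrier L. \<forall>y\<in>carrier L. \<forall>z\<in>carrier L.
        x \<sqinter>\<^bsub>L\<^esub> (y \<squnion>\<^bsub>L\<^esub> z) .=\<^bsub>L\<^esub> (x \<sqinter>\<^bsub>L\<^esub> y) \<squnion>\<^bsub>L\<^esub> (x \<sqinter>\<^bsub>L\<^esub> z))"

definition exact_arithmetical_category :: "('o, 'a) cat_data \<Rightarrow> bool" where
  "exact_arithmetical_category C \<longleftrightarrow> exact_category C \<and> maltsev_category C \<and>
     (\<forall>X\<in>Obj C. distributive_lattice (Equiv C X))"


section \<open>The diagram of three pairwise pushouts\<close>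

text \<open>For \<open>i < j\<close> in \<open>{1, 2, 3}\<close>, the edges \<open>EL i j\<close> and \<open>ER i j\<close> are the two pushout
  coprojections \<open>p i j : B i \<rightarrow> D i j\<close> and \<open>q i j : B j \<rightarrow> D i j\<close>.\<close>

datatype pp_vertex = VB nat | VD nat nat
datatype pp_edge = EL nat nat | ER nat nat

definition pushouts_diagram ::
    "('o, 'a) cat_data \<Rightarrow> (nat \<Rightarrow> 'a) \<Rightarrow> (nat \<Rightarrow> nat \<Rightarrow> 'a) \<Rightarrow> (nat \<Rightarrow> nat \<Rightarrow> 'a)
      \<Rightarrow> (pp_vertex, pp_edge, 'o, 'a) diagram" where
  "pushouts_diagram C r p q =
     \<lparr> Vert = {VB i | i. i \<in> {1..3}} \<union> {VD i j | i j. i \<in> {1..3} \<and> j \<in> {1..3} \<and> i < j},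
       Edge = {EL i j | i j. i \<in> {1..3} \<and> j \<in> {1..3} \<and> i < j} \<union>
              {ER i j | i j. i \<in> {1..3} \<and> j \<in> {1..3} \<and> i < j},
       src = (\<lambda>e. case e of EL i j \<Rightarrow> VB i | ER i j \<Rightarrow> VB j),
       tgt = (\<lambda>e. case e of EL i j \<Rightarrow> VD i j | ER i j \<Rightarrow> VD i j),
       Dob = (\<lambda>v. case v of VB i \<Rightarrow> Cod C (r i) | VD i j \<Rightarrow> Cod C (p i j)),
       Dar = (\<lambda>e. case e of EL i j \<Rightarrow> p i j | ER i j \<Rightarrow> q i j) \<rparr>"

end

theory Submission
  imports Defs
begin

text \<open>In a regular category one may argue with generalized elements, provided existence is
  understood locally, that is, after precomposition with a regular epimorphism. Let \<open>R\<^sub>i\<close> be the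
  kernel pair of \<open>r\<^sub>i\<close>.

  If the category is exact arithmetical, the pushout of \<open>(r\<^sub>i, r\<^sub>j)\<close> is the quotient of \<open>X\<close> by
  \<open>R\<^sub>i \<circ> R\<^sub>j\<close>. Given an element \<open>(b\<^sub>1, b\<^sub>2, b\<^sub>3)\<close> of \<open>L\<close>, there are locally \<open>y\<close> over \<open>(b\<^sub>1, b\<^sub>2)\<close> and \<open>x\<close>
  over \<open>b\<^sub>3\<close>, and \<open>(y, x)\<close> lies in \<open>(R\<^sub>1 \<or> R\<^sub>3) \<and> (R\<^sub>2 \<or> R\<^sub>3) = (R\<^sub>1 \<and> R\<^sub>2) \<circ> R\<^sub>3\<close>; the middle element
  of this composite is a preimage of \<open>(b\<^sub>1, b\<^sub>2, b\<^sub>3)\<close>.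

  Conversely, the condition applied to the two legs of a reflexive relation (the second leg taken
  twice) shows that the relation is the kernel pair of the pushout coprojection, which gives the
  Mal'tsev property and exactness together. For equivalence relations \<open>x, y, z\<close> and \<open>(u, v)\<close> in
  \<open>x \<and> (y \<or> z)\<close>, the triple \<open>([u], [u], [v])\<close> of classes modulo \<open>x, y, z\<close> is an element of the limit;
  its local preimage \<open>w\<close> satisfies \<open>u (x \<and> y) w (x \<and> z) v\<close>.\<close>

section \<open>Arrows, pullbacks and regular epimorphisms\<close>

text \<open>Every existence claim costs a cover, and each later claim refines the stage again. Two
  facts keep this under control: covers compose, so that a chain of lifts ends in a single cover;
  and membership in a relation descends along a cover, because a relation is a monomorphism. Hence a
  cover survives only where an element is produced, never where a relation is checked.

  In the converse, reflexivity acts twice. The common section of the two legs makes them split,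
  hence regular, epimorphisms, so that the condition applies to them; and it forces the two
  coprojections of their pushout to coincide, so that there is a single arrow out of
  \<open>X\<close> whose kernel pair can be compared with the relation. Repeating the second leg
  turns a compatible pair into a compatible triple.

  The Mal'tsev property must be available before distributivity is discussed: it makes the composite
  of two equivalence relations an equivalence relation, hence their join, and only then does the
  distributive law become a statement about generalized elements.\<close>

declare Hom_def [simp]

context category
begin

lemma comp_in_Arr [simp]:
  assumes "f \<in> Arr C" "g \<in> Arr C" "Cod C f = Dom C g"
  shows "g \<cdot> f \<in> Arr C" "Dom C (g \<cdot> f) = Dom C f" "Cod C (g \<cdot> f) = Cod C g"
  using Comp_Hom[of f "Dom C f" "Cod C f" g "Cod C g"] assms by auto

lemma comp_assoc [simp]:
  assumes "f \<in> Arr C" "g \<in> Arr C" "h \<in> Arr C" "Cod C f = Dom C g" "Cod C g = Dom C h"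
  shows "(h \<cdot> g) \<cdot> f = h \<cdot> (g \<cdot> f)"
  using Comp_assoc[of f _ _ g _ h] assms by auto

text \<open>Composites are normalized to right-nested form, where an equation
  \<open>g \<cdot> f = k\<close> no longer matches once something precedes \<open>f\<close>. This is
  the form in which such an equation can still be applied.\<close>

lemma comp_extend:
  assumes "g \<cdot> f = k" "x \<in> Arr C" "f \<in> Arr C" "g \<in> Arr C" "Cod C x = Dom C f" "Cod C f = Dom C g"
  shows "g \<cdot> (f \<cdot> x) = k \<cdot> x"
  using comp_assoc[of x f g] assms by simp

text \<open>Recovers the stage of a factorization from its defining equation, since
  \<open>related\<close> records only the codomain of the factoring arrow.\<close>

lemma comp_eq_Dom:
  assumes "g \<cdot> f = k" "f \<in> Arr C" "g \<in> Arr C" "Cod C f = Dom C g"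
  shows "Dom C f = Dom C k"
  using comp_in_Arr(2)[of f g] assms by simp

lemma ident_in_Arr [simp]:
  assumes "X \<in> Obj C"
  shows "Ident C X \<in> Arr C" "Dom C (Ident C X) = X" "Cod C (Ident C X) = X"
  using Ident_Hom[OF assms] by auto

lemma comp_ident [simp]:
  assumes "f \<in> Arr C"
  shows "Dom C f = X \<Longrightarrow> f \<cdot> Ident C X = f" "Cod C f = X \<Longrightarrow> Ident C X \<cdot> f = f"
  using Ident_right[of f "Dom C f" "Cod C f"] Ident_left[of f "Dom C f" "Cod C f"] assms by auto

lemma Dom_Cod_Obj [simp]:
  assumes "f \<in> Arr C"
  shows "Dom C f \<in> Obj C" "Cod C f \<in> Obj C"
  using Dom_Obj Cod_Obj assms by auto

lemma monoD:
  assumes "is_mono C m" "m \<cdot> u = m \<cdot> v" "u \<in> Arr C" "v \<in> Arr C"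
    "Cod C u = Dom C m" "Cod C v = Dom C m" "Dom C u = Dom C v"
  shows "u = v"
proof -
  have "u \<in> Hom C (Dom C v) (Dom C m)" "v \<in> Hom C (Dom C v) (Dom C m)"
    using assms by auto
  then show ?thesis
    using assms(1,2) Dom_Obj[OF assms(4)] unfolding is_mono_def by blast
qed

lemma coequalizer_ex1:
  assumes "is_coequalizer C f g c" "T \<in> Obj C" "u \<in> Hom C (Cod C f) T" "u \<cdot> f = u \<cdot> g"
  shows "\<exists>!h. h \<in> Hom C (Cod C c) T \<and> h \<cdot> c = u"
  using assms unfolding is_coequalizer_def
  by (elim conjE) (drule (1) bspec, drule (1) bspec, drule (1) mp, assumption)

lemma coequalizer_factor:
  assumes "is_coequalizer C f g c" "u \<in> Arr C" "Dom C u = Cod C f" "u \<cdot> f = u \<cdot> g"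
  obtains h where "h \<in> Arr C" "Dom C h = Cod C c" "Cod C h = Cod C u" "h \<cdot> c = u"
proof -
  have "u \<in> Hom C (Cod C f) (Cod C u)"
    using assms by simp
  from coequalizer_ex1[OF assms(1) Cod_Obj[OF assms(2)] this assms(4)] show ?thesis
    using that by auto
qed

section \<open>Regular epimorphisms\<close>

lemma regular_epi_Arr [simp]: "regular_epi C e \<Longrightarrow> e \<in> Arr C"
  unfolding regular_epi_def is_coequalizer_def by auto

text \<open>Both \<open>u\<close> and \<open>v\<close> mediate for the same arrow
  \<open>u \<cdot> e\<close> out of the coequalized pair. Equality of their codomains is part of
  what the equation yields.\<close>

lemma regular_epi_cancel:
  assumes e: "regular_epi C e" and u: "u \<in> Arr C" "Dom C u = Cod C e"
    and v: "v \<in> Arr C" "Dom C v = Cod C e" and eq: "u \<cdot> e = v \<cdot> e"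
  shows "u = v"
proof -
  obtain f g where fg: "is_coequalizer C f g e"
    using e unfolding regular_epi_def by auto
  then have ar: "f \<in> Arr C" "g \<in> Arr C" "e \<in> Arr C" "Dom C f = Dom C g" "Cod C f = Cod C g"
     "Dom C e = Cod C f" "e \<cdot> f = e \<cdot> g"
    unfolding is_coequalizer_def by auto
  have "Cod C u = Cod C v"
    using comp_in_Arr(3)[of e u] comp_in_Arr(3)[of e v] ar u v eq by simp
  moreover have "(u \<cdot> e) \<cdot> f = (u \<cdot> e) \<cdot> g"
    using ar u by simp
  moreover have "u \<cdot> e \<in> Hom C (Cod C f) (Cod C u)"
    using ar u by simp
  ultimately have "\<exists>!h. h \<in> Hom C (Cod C e) (Cod C u) \<and> h \<cdot> e = u \<cdot> e"
    using coequalizer_ex1[OF fg Cod_Obj[OF u(1)]] by blast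
  then show ?thesis
    using u v eq \<open>Cod C u = Cod C v\<close> by auto
qed

text \<open>The arrow \<open>e\<close> is the coequalizer of the identity and the idempotent
  \<open>s \<cdot> e\<close>.\<close>

lemma split_epi_regular:
  assumes ar: "e \<in> Arr C" "s \<in> Arr C" "Dom C s = Cod C e" "Cod C s = Dom C e"
    and es: "e \<cdot> s = Ident C (Cod C e)"
  shows "regular_epi C e"
proof -
  have "is_coequalizer C (Ident C (Dom C e)) (s \<cdot> e) e"
    unfolding is_coequalizer_def
  proof (intro conjI ballI impI)
    show "e \<cdot> Ident C (Dom C e) = e \<cdot> (s \<cdot> e)"
      using ar comp_extend[OF es, of e] by simp
  next
    fix T u
    assume "u \<in> Hom C (Cod C (Ident C (Dom C e))) T"
      and eq: "u \<cdot> Ident C (Dom C e) = u \<cdot> (s \<cdot> e)"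
    then have u: "u \<in> Arr C" "Dom C u = Dom C e" "Cod C u = T"
      using ar by auto
    show "\<exists>!h. h \<in> Hom C (Cod C e) T \<and> h \<cdot> e = u"
    proof (intro ex1I conjI)
      show "u \<cdot> s \<in> Hom C (Cod C e) T" "(u \<cdot> s) \<cdot> e = u"
        using ar u eq by auto
    next
      fix h
      assume h: "h \<in> Hom C (Cod C e) T \<and> h \<cdot> e = u"
      have "u \<cdot> s = h \<cdot> (e \<cdot> s)"
        using h ar by auto
      then show "h = u \<cdot> s"
        using h es by simp
    qed
  qed (use ar in auto)
  then show ?thesis
    unfolding regular_epi_def by blast
qed

text \<open>The pair coequalized by \<open>m \<cdot> h\<close> is already coequalized by
  \<open>h\<close>, as \<open>m\<close> is monic. So \<open>h\<close> factors through
  \<open>m \<cdot> h\<close>, and the factor \<open>k\<close> is inverse to \<open>m\<close>: on one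
  side by cancelling the epimorphism, on the other by cancelling \<open>m\<close>.\<close>

lemma mono_regular_epi_section:
  assumes m: "is_mono C m" and h: "h \<in> Arr C" "Cod C h = Dom C m" and mh: "regular_epi C (m \<cdot> h)"
  obtains k where "k \<in> Arr C" "Dom C k = Cod C m" "Cod C k = Dom C m"
    "m \<cdot> k = Ident C (Cod C m)" "k \<cdot> m = Ident C (Dom C m)"
proof -
  have mA: "m \<in> Arr C"
    using m unfolding is_mono_def by auto
  obtain f g where fg: "is_coequalizer C f g (m \<cdot> h)"
    using mh unfolding regular_epi_def by auto
  then have ar: "f \<in> Arr C" "g \<in> Arr C" "Dom C f = Dom C g" "Cod C f = Dom C h" "Cod C g = Dom C h"
     "(m \<cdot> h) \<cdot> f = (m \<cdot> h) \<cdot> g"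
    using h mA unfolding is_coequalizer_def by auto
  have "h \<cdot> f = h \<cdot> g"
    by (rule monoD[OF m]) (use ar h mA in auto)
  then obtain k where k: "k \<in> Arr C" "Dom C k = Cod C m" "Cod C k = Dom C m" "k \<cdot> (m \<cdot> h) = h"
    using coequalizer_factor[OF fg h(1)] ar h mA by auto
  have 1: "m \<cdot> k = Ident C (Cod C m)"
    by (rule regular_epi_cancel[OF mh]) (use k h mA in auto)
  have "k \<cdot> m = Ident C (Dom C m)"
    by (rule monoD[OF m]) (use k mA comp_extend[OF 1, of m] in auto)
  with 1 k that show ?thesis
    by blast
qed

section \<open>Pullbacks and kernel pairs\<close>

lemma is_pullbackD:
  assumes "is_pullback C f g p q"
  shows "f \<in> Arr C" "g \<in> Arr C" "p \<in> Arr C" "q \<in> Arr C" "Cod C f = Cod C g"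
    "Cod C p = Dom C f" "Cod C q = Dom C g" "Dom C q = Dom C p" "f \<cdot> p = g \<cdot> q"
  using assms unfolding is_pullback_def by auto

lemma pullback_ex1:
  assumes "is_pullback C f g p q" "T \<in> Obj C" "u \<in> Hom C T (Dom C f)" "v \<in> Hom C T (Dom C g)"
    "f \<cdot> u = g \<cdot> v"
  shows "\<exists>!h. h \<in> Hom C T (Dom C p) \<and> p \<cdot> h = u \<and> q \<cdot> h = v"
  using assms unfolding is_pullback_def
  by (elim conjE) (drule (1) bspec, drule (1) bspec, drule (1) bspec, drule (1) mp, assumption)

lemma pullback_factor:
  assumes "is_pullback C f g p q" "u \<in> Arr C" "v \<in> Arr C" "Dom C u = T" "Dom C v = T"
    "Cod C u = Dom C f" "Cod C v = Dom C g" "f \<cdot> u = g \<cdot> v"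
  obtains h where "h \<in> Arr C" "Dom C h = T" "Cod C h = Dom C p" "p \<cdot> h = u" "q \<cdot> h = v"
proof -
  have "u \<in> Hom C T (Dom C f)" "v \<in> Hom C T (Dom C g)" "T \<in> Obj C"
    using assms by auto
  from pullback_ex1[OF assms(1) this(3,1,2) assms(8)] show ?thesis
    using that by auto
qed

text \<open>Any pair that \<open>e\<close> coequalizes factors through the kernel pair, so an arrow
  equalizing the kernel pair equalizes that pair as well.\<close>

lemma coequalizer_kernel_pair:
  assumes e: "regular_epi C e" and pq: "is_kernel_pair C e p q"
  shows "is_coequalizer C p q e"
proof -
  note pq = pq[unfolded is_kernel_pair_def]
  note ar = is_pullbackD[OF pq]
  obtain f g where fg: "is_coequalizer C f g e"
    using e unfolding regular_epi_def by auto
  then have ar': "f \<in> Arr C" "g \<in> Arr C" "Dom C f = Dom C g" "Cod C f = Dom C e" "Cod C g = Dom C e"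
     "e \<cdot> f = e \<cdot> g"
    unfolding is_coequalizer_def by auto
  obtain k where k: "k \<in> Arr C" "Dom C k = Dom C g" "Cod C k = Dom C p" "p \<cdot> k = f" "q \<cdot> k = g"
    by (rule pullback_factor[OF pq, of f g "Dom C g"]) (use ar' in auto)
  show ?thesis
    unfolding is_coequalizer_def
  proof (intro conjI ballI impI)
    fix T u
    assume u: "u \<in> Hom C (Cod C p) T" and eq: "u \<cdot> p = u \<cdot> q"
    have "u \<cdot> f = u \<cdot> g"
      using comp_extend[OF eq, of k] u k ar by simp
    then obtain h where h: "h \<in> Arr C" "Dom C h = Cod C e" "Cod C h = T" "h \<cdot> e = u"
      using coequalizer_factor[OF fg, of u] u ar ar' by auto
    then show "\<exists>!h. h \<in> Hom C (Cod C e) T \<and> h \<cdot> e = u"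
      using regular_epi_cancel[OF e] by (intro ex1I[of _ h]) auto
  qed (use ar in auto)
qed

end

text \<open>Finite completeness is formulated for diagrams indexed by natural numbers, while the
  diagram of pushouts has vertices and edges of its own types. Reindexing along injections into the
  natural numbers leaves cones unchanged.\<close>

lemma finitely_complete_limit_exists:
  fixes C :: "('o, 'a) cat_data"
  assumes fc: "finitely_complete C" and D: "is_diagram C D" "finite (Vert D)" "finite (Edge D)"
  shows "\<exists>L \<pi>. is_limit C D L \<pi>"
proof -
  obtain f :: "_ \<Rightarrow> nat" where f: "inj_on f (Vert D)"
    using finite_imp_inj_to_nat_seg D(2) by blast
  obtain g :: "_ \<Rightarrow> nat" where g: "inj_on g (Edge D)"
    using finite_imp_inj_to_nat_seg D(3) by blast
  let ?f = "inv_into (Vert D) f" and ?g = "inv_into (Edge D) g"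
  define D' where "D' = \<lparr> Vert = f ` Vert D, Edge = g ` Edge D, src = f \<circ> src D \<circ> ?g,
    tgt = f \<circ> tgt D \<circ> ?g, Dob = Dob D \<circ> ?f, Dar = Dar D \<circ> ?g \<rparr>"
  have [simp]: "?f (f v) = v" if "v \<in> Vert D" for v
    using f that by (rule inv_into_f_f)
  have [simp]: "?g (g e) = e" if "e \<in> Edge D" for e
    using g that by (rule inv_into_f_f)
  have vert: "src D e \<in> Vert D" "tgt D e \<in> Vert D" if "e \<in> Edge D" for e
    using D(1) that unfolding is_diagram_def by auto
  have "is_diagram C D'"
    using D(1) vert unfolding is_diagram_def D'_def by auto
  moreover have "finite (Vert D')" "finite (Edge D')"
    using D unfolding D'_def by auto
  ultimately obtain L \<pi> where L: "is_limit C D' L \<pi>"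
    using fc unfolding finitely_complete_def by blast
  have cone: "is_cone C D' X \<mu> \<longleftrightarrow> is_cone C D X (\<mu> \<circ> f)" for X \<mu>
    using vert unfolding is_cone_def D'_def by auto
  have "is_limit C D L (\<pi> \<circ> f)"
    unfolding is_limit_def
  proof (intro conjI allI impI)
    show "is_cone C D L (\<pi> \<circ> f)"
      using L unfolding is_limit_def cone by simp
  next
    fix X \<mu>
    assume \<mu>: "is_cone C D X \<mu>"
    have "is_cone C D X (\<mu> \<circ> ?f \<circ> f)"
      using \<mu> vert unfolding is_cone_def by auto
    then have "\<exists>!h. h \<in> Hom C X L \<and> (\<forall>v\<in>Vert D'. \<pi> v \<cdot>\<^bsub>C\<^esub> h = (\<mu> \<circ> ?f) v)"
      using L unfolding is_limit_def cone by blast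
    then show "\<exists>!h. h \<in> Hom C X L \<and> (\<forall>v\<in>Vert D. (\<pi> \<circ> f) v \<cdot>\<^bsub>C\<^esub> h = \<mu> v)"
      unfolding D'_def by auto
  qed
  then show ?thesis
    by blast
qed

section \<open>Finite limits, covers and images in a regular category\<close>

locale regular_cat = category C for C :: "('o, 'a) cat_data" (structure) +
  assumes regular: "regular_category C"
begin

lemma finitely_complete: "finitely_complete C"
  using regular unfolding regular_category_def by simp

lemma finite_limit_exists:
  assumes "is_diagram C D" "finite (Vert D)" "finite (Edge D)"
  obtains L \<pi> where "is_limit C D L \<pi>"
  using finitely_complete_limit_exists[OF finitely_complete assms] by blast

lemma pullback_exists:
  assumes f: "f \<in> Arr C" and g: "g \<in> Arr C" and cod: "Cod C f = Cod C g"
  obtains p q where "is_pullback C f g p q"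
proof -
  define D :: "(nat, nat, 'o, 'a) diagram" where
    "D = \<lparr> Vert = {0, 1, 2}, Edge = {0, 1}, src = id, tgt = (\<lambda>_. 2),
      Dob = (\<lambda>v. if v = 0 then Dom C f else if v = 1 then Dom C g else Cod C f),
      Dar = (\<lambda>e. if e = 0 then f else g) \<rparr>"
  have "is_diagram C D" "finite (Vert D)" "finite (Edge D)"
    using assms unfolding is_diagram_def D_def by auto
  then obtain L \<pi> where L: "is_limit C D L \<pi>"
    by (rule finite_limit_exists)
  have \<pi>: "\<pi> 0 \<in> Arr C" "\<pi> 1 \<in> Arr C" "\<pi> 2 \<in> Arr C" "Dom C (\<pi> 0) = L" "Dom C (\<pi> 1) = L"
    "Cod C (\<pi> 0) = Dom C f" "Cod C (\<pi> 1) = Dom C g" "f \<cdot> \<pi> 0 = \<pi> 2" "g \<cdot> \<pi> 1 = \<pi> 2"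
    using L unfolding is_limit_def is_cone_def D_def by auto
  have "is_pullback C f g (\<pi> 0) (\<pi> 1)"
    unfolding is_pullback_def
  proof (intro conjI ballI impI)
    fix T u v
    assume T: "T \<in> Obj C" and u: "u \<in> Hom C T (Dom C f)" and v: "v \<in> Hom C T (Dom C g)"
      and eq: "f \<cdot> u = g \<cdot> v"
    let ?\<mu> = "\<lambda>i :: nat. if i = 0 then u else if i = 1 then v else f \<cdot> u"
    have "is_cone C D T ?\<mu>"
      using T u v eq f g cod unfolding is_cone_def D_def by auto
    then have ex: "\<exists>!h. h \<in> Hom C T L \<and> (\<forall>i\<in>Vert D. \<pi> i \<cdot> h = ?\<mu> i)"
      using L unfolding is_limit_def by blast
    have "(h \<in> Hom C T L \<and> (\<forall>i\<in>Vert D. \<pi> i \<cdot> h = ?\<mu> i)) \<longleftrightarrow>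
        h \<in> Hom C T (Dom C (\<pi> 0)) \<and> \<pi> 0 \<cdot> h = u \<and> \<pi> 1 \<cdot> h = v" for h
      using comp_extend[OF \<pi>(8), of h] \<pi> f unfolding D_def by auto
    with ex show "\<exists>!h. h \<in> Hom C T (Dom C (\<pi> 0)) \<and> \<pi> 0 \<cdot> h = u \<and> \<pi> 1 \<cdot> h = v"
      by simp
  qed (use \<pi> assms in auto)
  then show ?thesis
    using that by blast
qed

lemma product_exists:
  assumes "X \<in> Obj C" "Y \<in> Obj C"
  obtains p q where "is_product C X Y p q"
proof -
  define D :: "(nat, nat, 'o, 'a) diagram" where
    "D = \<lparr> Vert = {0, 1}, Edge = {}, src = id, tgt = id,
      Dob = (\<lambda>v. if v = 0 then X else Y), Dar = undefined \<rparr>"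
  have "is_diagram C D" "finite (Vert D)" "finite (Edge D)"
    using assms unfolding is_diagram_def D_def by auto
  then obtain L \<pi> where L: "is_limit C D L \<pi>"
    by (rule finite_limit_exists)
  have \<pi>: "\<pi> 0 \<in> Hom C L X" "\<pi> 1 \<in> Hom C L Y"
    using L unfolding is_limit_def is_cone_def D_def by auto
  have "is_product C X Y (\<pi> 0) (\<pi> 1)"
    unfolding is_product_def
  proof (intro conjI ballI)
    fix T u v
    assume uv: "T \<in> Obj C" "u \<in> Hom C T X" "v \<in> Hom C T Y"
    have "is_cone C D T (\<lambda>i. if i = 0 then u else v)"
      using uv unfolding is_cone_def D_def by auto
    then have "\<exists>!h. h \<in> Hom C T L \<and> (\<forall>i\<in>Vert D. \<pi> i \<cdot> h = (if i = 0 then u else v))"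
      using L unfolding is_limit_def by blast
    then show "\<exists>!h. h \<in> Hom C T (Dom C (\<pi> 0)) \<and> \<pi> 0 \<cdot> h = u \<and> \<pi> 1 \<cdot> h = v"
      using \<pi> unfolding D_def by simp
  qed (use \<pi> in auto)
  then show ?thesis
    using that by blast
qed

text \<open>The finer stage \<open>T'\<close> comes before the stage \<open>T\<close> that it
  covers. Both ends are recorded so that stages can be followed through successive lifts.\<close>

definition cover :: "'a \<Rightarrow> 'o \<Rightarrow> 'o \<Rightarrow> bool" where
  "cover c T' T \<longleftrightarrow> regular_epi C c \<and> c \<in> Hom C T' T"

lemma coverD:
  assumes "cover c T' T"
  shows "regular_epi C c" "c \<in> Arr C" "Dom C c = T'" "Cod C c = T"
  using assms unfolding cover_def by auto

text \<open>The cover is the pullback of \<open>e\<close> along \<open>b\<close>, a regular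
  epimorphism by stability; the other projection is the lift.\<close>

lemma regular_epi_lift:
  assumes "regular_epi C e" "b \<in> Arr C" "Dom C b = T" "Cod C b = Cod C e"
  obtains T' c z where "cover c T' T" "z \<in> Arr C" "Dom C z = T'" "Cod C z = Dom C e" "e \<cdot> z = b \<cdot> c"
proof -
  have e: "e \<in> Arr C"
    using assms by simp
  obtain z c where pb: "is_pullback C e b z c"
    using pullback_exists[OF e assms(2)] assms by auto
  then have "regular_epi C c"
    using regular assms(1) unfolding regular_category_def by blast
  then have "cover c (Dom C c) T"
    using is_pullbackD[OF pb] assms unfolding cover_def by simp
  then show ?thesis
    by (rule that[of c "Dom C c" z]) (use is_pullbackD[OF pb] in auto)
qed

text \<open>Take for \<open>e\<close> the coequalizer of the kernel pair of \<open>f\<close>. Two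
  elements identified by \<open>m\<close> lift locally along \<open>e\<close> to elements identified
  by \<open>f\<close>; these form an element of the kernel pair, so \<open>e\<close> identifies
  them.\<close>

lemma image_factorization:
  assumes f: "f \<in> Arr C"
  obtains e m where "regular_epi C e" "is_mono C m" "Dom C e = Dom C f" "Cod C e = Dom C m"
    "Cod C m = Cod C f" "m \<cdot> e = f"
proof -
  obtain p q where pq: "is_pullback C f f p q"
    using pullback_exists[OF f f] by auto
  note ar = is_pullbackD[OF pq]
  obtain e where e: "is_coequalizer C p q e"
    using regular pq unfolding regular_category_def is_kernel_pair_def by blast
  then have re: "regular_epi C e"
    unfolding regular_epi_def by blast
  have eA: "e \<in> Arr C" "Dom C e = Dom C f" "e \<cdot> p = e \<cdot> q"
    using e ar unfolding is_coequalizer_def by auto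
  obtain m where m: "m \<in> Arr C" "Dom C m = Cod C e" "Cod C m = Cod C f" "m \<cdot> e = f"
    by (rule coequalizer_factor[OF e, of f]) (use ar in auto)
  have "is_mono C m"
    unfolding is_mono_def
  proof (intro conjI ballI impI)
    fix T u v
    assume T: "T \<in> Obj C" and u: "u \<in> Hom C T (Dom C m)" and v: "v \<in> Hom C T (Dom C m)"
      and eq: "m \<cdot> u = m \<cdot> v"
    obtain T1 c x where c: "cover c T1 T" and x: "x \<in> Arr C" "Dom C x = T1" "Cod C x = Dom C e"
        "e \<cdot> x = u \<cdot> c"
      by (rule regular_epi_lift[OF re, of u T]) (use u m in auto)
    note c = coverD[OF c]
    \<comment> \<open>The second lift is taken over the stage of the first, so that
      \<open>x \<cdot> d\<close> and \<open>y\<close> share a stage.\<close>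
    obtain T2 d y where d: "cover d T2 T1" and y: "y \<in> Arr C" "Dom C y = T2" "Cod C y = Dom C e"
        "e \<cdot> y = (v \<cdot> c) \<cdot> d"
      by (rule regular_epi_lift[OF re, of "v \<cdot> c" T1]) (use v m c in auto)
    note d = coverD[OF d]
    have "f \<cdot> (x \<cdot> d) = m \<cdot> (e \<cdot> (x \<cdot> d))"
      using comp_extend[OF m(4), of "x \<cdot> d"] x d m eA by simp
    also have "\<dots> = m \<cdot> (u \<cdot> (c \<cdot> d))"
      using comp_extend[OF x(4), of d] x d m eA u c by simp
    also have "\<dots> = m \<cdot> (v \<cdot> (c \<cdot> d))"
      using comp_extend[OF eq, of "c \<cdot> d"] d m u v c by simp
    also have "\<dots> = m \<cdot> (e \<cdot> y)"
      using y v c d m by simp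
    also have "\<dots> = f \<cdot> y"
      using comp_extend[OF m(4), of y] y m eA by simp
    finally obtain k where k: "k \<in> Arr C" "Cod C k = Dom C p" "p \<cdot> k = x \<cdot> d" "q \<cdot> k = y"
      using pullback_factor[OF pq, of "x \<cdot> d" y T2] x y d eA by auto
    have "e \<cdot> (x \<cdot> d) = e \<cdot> y"
      using comp_extend[OF eA(3), of k] k ar eA by simp
    then have "(u \<cdot> c) \<cdot> d = (v \<cdot> c) \<cdot> d"
      using comp_extend[OF x(4), of d] x d m eA u c y by simp
    then have "u \<cdot> c = v \<cdot> c"
      by (rule regular_epi_cancel[OF d(1), rotated -1]) (use u v c d m in auto)
    then show "u = v"
      by (rule regular_epi_cancel[OF c(1), rotated -1]) (use u v c in auto)
  qed (rule m)
  with that[of e m] re m eA show ?thesis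
    by auto
qed

lemma regular_epi_comp_iso:
  assumes e: "regular_epi C e" and m: "m \<in> Arr C" "Cod C e = Dom C m"
    and k: "k \<in> Arr C" "Dom C k = Cod C m" "Cod C k = Dom C m"
      "m \<cdot> k = Ident C (Cod C m)" "k \<cdot> m = Ident C (Dom C m)"
  shows "regular_epi C (m \<cdot> e)"
proof -
  have eA: "e \<in> Arr C"
    using e by simp
  obtain f g where fg: "is_coequalizer C f g e"
    using e unfolding regular_epi_def by auto
  then have fgA: "f \<in> Arr C" "g \<in> Arr C" "Dom C f = Dom C g" "Cod C f = Dom C e" "Cod C g = Dom C e"
     "e \<cdot> f = e \<cdot> g"
    unfolding is_coequalizer_def by auto
  have kme: "k \<cdot> (m \<cdot> e) = e"
    using comp_extend[OF k(5), of e] eA m k by simp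
  have "is_coequalizer C f g (m \<cdot> e)"
    unfolding is_coequalizer_def
  proof (intro conjI ballI impI)
    show "(m \<cdot> e) \<cdot> f = (m \<cdot> e) \<cdot> g"
      using fgA m eA by simp
  next
    fix T u
    assume u: "u \<in> Hom C (Cod C f) T" and eq: "u \<cdot> f = u \<cdot> g"
    obtain h where h: "h \<in> Arr C" "Dom C h = Cod C e" "Cod C h = T" "h \<cdot> e = u"
      by (rule coequalizer_factor[OF fg, of u]) (use u eq in auto)
    show "\<exists>!h. h \<in> Hom C (Cod C (m \<cdot> e)) T \<and> h \<cdot> (m \<cdot> e) = u"
    proof (intro ex1I conjI)
      show "h \<cdot> k \<in> Hom C (Cod C (m \<cdot> e)) T" "(h \<cdot> k) \<cdot> (m \<cdot> e) = u"
        using h k m eA kme by auto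
    next
      fix h'
      assume h': "h' \<in> Hom C (Cod C (m \<cdot> e)) T \<and> h' \<cdot> (m \<cdot> e) = u"
      have "h' \<cdot> m = h"
        by (rule regular_epi_cancel[OF e]) (use h h' m eA in auto)
      then show "h' = h \<cdot> k"
        using h' k m eA by auto
    qed
  qed (use fgA m eA in auto)
  then show ?thesis
    unfolding regular_epi_def by blast
qed

text \<open>The monic part of the image of \<open>a\<close> becomes a regular epimorphism after
  precomposition, hence is invertible, and \<open>a\<close> is its regular epic part up to
  isomorphism.\<close>

lemma regular_epi_right_factor:
  assumes az: "regular_epi C (a \<cdot> z)" and ar: "a \<in> Arr C" "z \<in> Arr C" "Cod C z = Dom C a"
  shows "regular_epi C a"
proof -
  obtain e m where e: "regular_epi C e" and m: "is_mono C m"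
    and em: "Dom C e = Dom C a" "Cod C e = Dom C m" "Cod C m = Cod C a" "m \<cdot> e = a"
    using image_factorization[OF ar(1)] by blast
  have mA: "m \<in> Arr C"
    using m unfolding is_mono_def by auto
  have "m \<cdot> (e \<cdot> z) = a \<cdot> z"
    using comp_extend[OF em(4), of z] ar em mA e by simp
  then have "regular_epi C (m \<cdot> (e \<cdot> z))"
    using az by simp
  then obtain k where k: "k \<in> Arr C" "Dom C k = Cod C m" "Cod C k = Dom C m"
      "m \<cdot> k = Ident C (Cod C m)" "k \<cdot> m = Ident C (Dom C m)"
    by (rule mono_regular_epi_section[OF m, rotated 2]) (use ar em e in auto)
  have "regular_epi C (m \<cdot> e)"
    by (rule regular_epi_comp_iso[OF e mA em(2) k])
  then show ?thesis
    by (simp add: em)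
qed

text \<open>Regular epimorphisms do not compose in an arbitrary category; here the image of
  \<open>c \<cdot> d\<close> helps. As \<open>d\<close> is a coequalizer, \<open>c\<close> factors
  through the monic part \<open>m\<close>, which is therefore a regular epimorphism and a
  monomorphism, hence invertible.\<close>

lemma cover_comp:
  assumes c: "cover c T' T" and d: "cover d T'' T'"
  shows "cover (c \<cdot> d) T'' T"
proof -
  note cA = coverD[OF c] and dA = coverD[OF d]
  obtain e m where e: "regular_epi C e" and m: "is_mono C m"
    and em: "Dom C e = T''" "Cod C e = Dom C m" "Cod C m = T" "m \<cdot> e = c \<cdot> d"
    using image_factorization[of "c \<cdot> d"] cA dA by auto
  have mA: "m \<in> Arr C"
    using m unfolding is_mono_def by auto
  obtain f g where fg: "is_coequalizer C f g d"
    using dA(1) unfolding regular_epi_def by auto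
  then have fgA: "f \<in> Arr C" "g \<in> Arr C" "Dom C f = Dom C g" "Cod C f = Dom C d" "Cod C g = Dom C d"
     "d \<cdot> f = d \<cdot> g"
    unfolding is_coequalizer_def by auto
  have "e \<cdot> f = e \<cdot> g"
    by (rule monoD[OF m])
      (use comp_extend[OF em(4), of f] comp_extend[OF em(4), of g] fgA em e mA cA dA in auto)
  then obtain h where h: "h \<in> Arr C" "Dom C h = Cod C d" "Cod C h = Cod C e" "h \<cdot> d = e"
    by (rule coequalizer_factor[OF fg, of e, rotated 2]) (use e em fgA dA in auto)
  have "m \<cdot> h = c"
    by (rule regular_epi_cancel[OF dA(1)]) (use h em mA cA dA in auto)
  then have "regular_epi C m"
    by (intro regular_epi_right_factor[of m h]) (use cA h em mA in auto)
  then obtain k where k: "k \<in> Arr C" "Dom C k = Cod C m" "Cod C k = Dom C m"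
      "m \<cdot> k = Ident C (Cod C m)" "k \<cdot> m = Ident C (Dom C m)"
    using mono_regular_epi_section[OF m, of "Ident C (Dom C m)"] mA by auto
  have "regular_epi C (m \<cdot> e)"
    by (rule regular_epi_comp_iso[OF e mA em(2) k])
  then show ?thesis
    using cA dA em unfolding cover_def by auto
qed

end

section \<open>Internal relations through generalized elements\<close>

context regular_cat
begin

definition parallel :: "'o \<Rightarrow> 'a \<Rightarrow> 'a \<Rightarrow> bool" where
  "parallel X u v \<longleftrightarrow> u \<in> Arr C \<and> v \<in> Arr C \<and> Dom C u = Dom C v \<and> Cod C u = X \<and> Cod C v = X"

text \<open>\<open>related X m u v\<close> says that the generalized element \<open>(u, v)\<close> of \<open>X \<times> X\<close> factors
  through \<open>m\<close>; its stage of definition is the common domain of \<open>u\<close> and \<open>v\<close>. The middle element of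
  a composite of relations exists only after passing to a cover of the stage, since the composite
  is the image of a span.\<close>

definition related :: "'o \<Rightarrow> 'a \<Rightarrow> 'a \<Rightarrow> 'a \<Rightarrow> bool" where
  "related X m u v \<longleftrightarrow>
     (\<exists>h\<in>Arr C. Cod C h = Dom C m \<and> leg0 C X m \<cdot> h = u \<and> leg1 C X m \<cdot> h = v)"

definition related_comp :: "'o \<Rightarrow> 'a \<Rightarrow> 'a \<Rightarrow> 'a \<Rightarrow> 'a \<Rightarrow> bool" where
  "related_comp X m n u v \<longleftrightarrow> parallel X u v \<and>
     (\<exists>T c y. cover c T (Dom C u) \<and> related X m (u \<cdot> c) y \<and> related X n y (v \<cdot> c))"

lemma square_proj_product:
  assumes "X \<in> Obj C"
  shows "is_product C X X (fst (square_proj C X)) (snd (square_proj C X))"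
proof -
  obtain p q where "is_product C X X p q"
    using product_exists[OF assms assms] by blast
  then have "is_product C X X (fst (p, q)) (snd (p, q))"
    by simp
  then show ?thesis
    unfolding square_proj_def by (rule someI)
qed

lemma square_proj_Arr [simp]:
  assumes "X \<in> Obj C"
  shows "fst (square_proj C X) \<in> Arr C" "Dom C (fst (square_proj C X)) = square C X"
    "Cod C (fst (square_proj C X)) = X"
    "snd (square_proj C X) \<in> Arr C" "Dom C (snd (square_proj C X)) = square C X"
    "Cod C (snd (square_proj C X)) = X"
  using square_proj_product[OF assms] unfolding is_product_def square_def by auto

lemma square_ex1:
  assumes "X \<in> Obj C" "parallel X u v"
  shows "\<exists>!h. h \<in> Hom C (Dom C u) (square C X) \<and>
    fst (square_proj C X) \<cdot> h = u \<and> snd (square_proj C X) \<cdot> h = v"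
proof -
  have "Dom C u \<in> Obj C" "u \<in> Hom C (Dom C u) X" "v \<in> Hom C (Dom C u) X"
    using assms unfolding parallel_def by auto
  then show ?thesis
    using square_proj_product[OF assms(1)] unfolding is_product_def square_def
    by (elim conjE) (drule (1) bspec, drule (1) bspec, drule (1) bspec, assumption)
qed

lemma square_eq:
  assumes X: "X \<in> Obj C" and h: "h \<in> Arr C" "Cod C h = square C X"
    and k: "k \<in> Arr C" "Cod C k = square C X"
    and eq: "fst (square_proj C X) \<cdot> h = fst (square_proj C X) \<cdot> k"
      "snd (square_proj C X) \<cdot> h = snd (square_proj C X) \<cdot> k"
  shows "h = k"
proof -
  let ?u = "fst (square_proj C X) \<cdot> k" and ?v = "snd (square_proj C X) \<cdot> k"
  have "parallel X ?u ?v"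
    using X k unfolding parallel_def by simp
  from square_ex1[OF X this] have "\<exists>!h. h \<in> Hom C (Dom C k) (square C X) \<and>
      fst (square_proj C X) \<cdot> h = ?u \<and> snd (square_proj C X) \<cdot> h = ?v"
    using X k by simp
  moreover have "Dom C h = Dom C k"
    using comp_eq_Dom[OF eq(1)] X h k by simp
  ultimately show ?thesis
    using h k eq by auto
qed

lemma legs [simp]:
  assumes "internal_relation C X m"
  shows "X \<in> Obj C" "m \<in> Arr C"
    "leg0 C X m \<in> Arr C" "Dom C (leg0 C X m) = Dom C m" "Cod C (leg0 C X m) = X"
    "leg1 C X m \<in> Arr C" "Dom C (leg1 C X m) = Dom C m" "Cod C (leg1 C X m) = X"
  using assms unfolding internal_relation_def is_mono_def leg0_def leg1_def by auto

text \<open>The two projections detect equality in the square, and \<open>m\<close> is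
  monic.\<close>

lemma legs_jointly_monic:
  assumes m: "internal_relation C X m" and h: "h \<in> Arr C" "Cod C h = Dom C m"
    and k: "k \<in> Arr C" "Cod C k = Dom C m"
    and eq: "leg0 C X m \<cdot> h = leg0 C X m \<cdot> k" "leg1 C X m \<cdot> h = leg1 C X m \<cdot> k"
  shows "h = k"
proof -
  have m': "X \<in> Obj C" "is_mono C m" "m \<in> Arr C" "Cod C m = square C X"
    using m unfolding internal_relation_def is_mono_def by auto
  have dom: "Dom C h = Dom C k"
    using comp_eq_Dom[OF eq(1)] m h k by simp
  have "m \<cdot> h = m \<cdot> k"
    by (rule square_eq[OF m'(1)]) (use eq m' h k in \<open>simp_all add: leg0_def leg1_def\<close>)
  then show ?thesis
    using monoD[OF m'(2)] h k dom by blast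
qed

lemma relatedD:
  assumes "internal_relation C X m" "related X m u v"
  shows "parallel X u v" "u \<in> Arr C" "v \<in> Arr C" "Dom C u = Dom C v" "Cod C u = X" "Cod C v = X"
  using assms unfolding related_def parallel_def by auto

lemma related_legs:
  assumes "internal_relation C X m"
  shows "related X m (leg0 C X m) (leg1 C X m)"
  using assms unfolding related_def by (intro bexI[of _ "Ident C (Dom C m)"]) auto

lemma related_precomp:
  assumes m: "internal_relation C X m" and uv: "related X m u v" and c: "c \<in> Arr C" "Cod C c = Dom C u"
  shows "related X m (u \<cdot> c) (v \<cdot> c)"
proof -
  obtain h where h: "h \<in> Arr C" "Cod C h = Dom C m" "leg0 C X m \<cdot> h = u" "leg1 C X m \<cdot> h = v"
    using uv unfolding related_def by auto
  have "Dom C h = Dom C u"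
    using h m by auto
  then show ?thesis
    using h m c comp_extend[OF h(3), of c] comp_extend[OF h(4), of c]
    unfolding related_def by (intro bexI[of _ "h \<cdot> c"]) auto
qed

text \<open>Descent along a cover: since the legs are jointly monic, the factorization found over
  the cover equalizes the pair of which \<open>c\<close> is the coequalizer, and so factors through
  \<open>c\<close>. This is what allows local arguments to prove global memberships.\<close>

lemma related_local:
  assumes m: "internal_relation C X m" and uv: "parallel X u v" and c: "cover c T (Dom C u)"
    and r: "related X m (u \<cdot> c) (v \<cdot> c)"
  shows "related X m u v"
proof -
  note cA = coverD[OF c]
  have uvA: "u \<in> Arr C" "v \<in> Arr C" "Dom C v = Dom C u" "Cod C u = X" "Cod C v = X"
    using uv unfolding parallel_def by auto
  obtain z where z: "z \<in> Arr C" "Cod C z = Dom C m" "leg0 C X m \<cdot> z = u \<cdot> c"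
      "leg1 C X m \<cdot> z = v \<cdot> c"
    using r unfolding related_def by auto
  have zT: "Dom C z = T"
    using comp_eq_Dom[OF z(3)] z m cA uvA by simp
  obtain f g where fg: "is_coequalizer C f g c"
    using cA(1) unfolding regular_epi_def by auto
  then have fgA: "f \<in> Arr C" "g \<in> Arr C" "Dom C f = Dom C g" "Cod C f = Dom C c" "Cod C g = Dom C c"
     "c \<cdot> f = c \<cdot> g"
    unfolding is_coequalizer_def by auto
  have "z \<cdot> f = z \<cdot> g"
    by (rule legs_jointly_monic[OF m])
      (use comp_extend[OF z(3), of f] comp_extend[OF z(3), of g] comp_extend[OF z(4), of f]
        comp_extend[OF z(4), of g] fgA z zT m cA uvA in auto)
  then obtain h where h: "h \<in> Arr C" "Dom C h = Cod C c" "Cod C h = Cod C z" "h \<cdot> c = z"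
    by (rule coequalizer_factor[OF fg, of z, rotated 2]) (use z fgA zT cA in auto)
  have "leg0 C X m \<cdot> h = u" "leg1 C X m \<cdot> h = v"
    by (rule regular_epi_cancel[OF cA(1)]; use h z m cA uvA in simp)+
  then show ?thesis
    using h z unfolding related_def by (intro bexI[of _ h]) auto
qed

lemma related_comp_intro:
  assumes m: "internal_relation C X m" and n: "internal_relation C X n"
    and uw: "related X m u w" and wv: "related X n w v"
  shows "related_comp X m n u v"
proof -
  note u = relatedD[OF m uw] and v = relatedD[OF n wv]
  \<comment> \<open>An identity is a cover, so a middle element existing at the given stage counts
    as a local one.\<close>
  have "cover (Ident C (Dom C u)) (Dom C u) (Dom C u)"
    using u split_epi_regular[of "Ident C (Dom C u)" "Ident C (Dom C u)"] unfolding cover_def by auto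
  then show ?thesis
    using u v uw wv unfolding related_comp_def parallel_def
    by (intro conjI exI[of _ "Dom C u"] exI[of _ "Ident C (Dom C u)"] exI[of _ w]) auto
qed

text \<open>The Yoneda argument: the pair of legs of \<open>m\<close> is its generic element, and
  membership of that element in \<open>n\<close> is a factorization of \<open>m\<close> through
  \<open>n\<close>.\<close>

lemma subobject_le_related:
  assumes m: "internal_relation C X m" and n: "internal_relation C X n"
  shows "subobject_le C m n \<longleftrightarrow> (\<forall>u v. related X m u v \<longrightarrow> related X n u v)"
proof
  assume "subobject_le C m n"
  then obtain h where h: "h \<in> Arr C" "Dom C h = Dom C m" "Cod C h = Dom C n" "n \<cdot> h = m"
    unfolding subobject_le_def by auto
  have cod: "Cod C m = square C X" "Cod C n = square C X"
    using m n unfolding internal_relation_def by auto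
  have legs_h: "leg0 C X n \<cdot> h = leg0 C X m" "leg1 C X n \<cdot> h = leg1 C X m"
    using h m n cod legs(1,2)[OF n] unfolding leg0_def leg1_def by auto
  show "\<forall>u v. related X m u v \<longrightarrow> related X n u v"
  proof (intro allI impI)
    fix u v
    assume "related X m u v"
    then obtain k where "k \<in> Arr C" "Cod C k = Dom C m" "leg0 C X m \<cdot> k = u" "leg1 C X m \<cdot> k = v"
      unfolding related_def by auto
    then show "related X n u v"
      using h n comp_extend[OF legs_h(1), of k] comp_extend[OF legs_h(2), of k]
      unfolding related_def by (intro bexI[of _ "h \<cdot> k"]) auto
  qed
next
  assume "\<forall>u v. related X m u v \<longrightarrow> related X n u v"
  then have "related X n (leg0 C X m) (leg1 C X m)"
    using related_legs[OF m] by blast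
  then obtain h where h: "h \<in> Arr C" "Cod C h = Dom C n" "leg0 C X n \<cdot> h = leg0 C X m"
      "leg1 C X n \<cdot> h = leg1 C X m"
    unfolding related_def by auto
  have cod: "Cod C m = square C X" "Cod C n = square C X" "m \<in> Arr C" "n \<in> Arr C" "X \<in> Obj C"
    using m n unfolding internal_relation_def is_mono_def by auto
  have dom: "Dom C h = Dom C m"
    using comp_eq_Dom[OF h(3)] h m n by simp
  have "n \<cdot> h = m"
    by (rule square_eq[OF cod(5)]) (use h cod in \<open>simp_all add: leg0_def leg1_def\<close>)
  then show "subobject_le C m n"
    using h dom unfolding subobject_le_def by (intro bexI[of _ h]) auto
qed

section \<open>Properties of relations tested on generic elements\<close>

lemma internal_reflexive_iff:
  assumes m: "internal_relation C X m"
  shows "internal_reflexive C X m \<longleftrightarrow> (\<forall>u\<in>Arr C. Cod C u = X \<longrightarrow> related X m u u)"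
proof
  assume "internal_reflexive C X m"
  then obtain s where s: "s \<in> Arr C" "Dom C s = X" "Cod C s = Dom C m"
      "leg0 C X m \<cdot> s = Ident C X" "leg1 C X m \<cdot> s = Ident C X"
    unfolding internal_reflexive_def by auto
  show "\<forall>u\<in>Arr C. Cod C u = X \<longrightarrow> related X m u u"
  proof (intro ballI impI)
    fix u
    assume u: "u \<in> Arr C" "Cod C u = X"
    then show "related X m u u"
      using s m comp_extend[OF s(4), of u] comp_extend[OF s(5), of u]
      unfolding related_def by (intro bexI[of _ "s \<cdot> u"]) auto
  qed
next
  assume "\<forall>u\<in>Arr C. Cod C u = X \<longrightarrow> related X m u u"
  then have "related X m (Ident C X) (Ident C X)"
    using m by simp
  then obtain s where s: "s \<in> Arr C" "Cod C s = Dom C m" "leg0 C X m \<cdot> s = Ident C X"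
      "leg1 C X m \<cdot> s = Ident C X"
    unfolding related_def by auto
  have "Dom C s = X"
    using comp_eq_Dom[OF s(3)] s m by simp
  then show "internal_reflexive C X m"
    using s unfolding internal_reflexive_def by (intro bexI[of _ s]) auto
qed

lemma internal_symmetric_iff:
  assumes m: "internal_relation C X m"
  shows "internal_symmetric C X m \<longleftrightarrow> (\<forall>u v. related X m u v \<longrightarrow> related X m v u)"
proof
  assume "internal_symmetric C X m"
  then obtain s where s: "s \<in> Arr C" "Dom C s = Dom C m" "Cod C s = Dom C m"
      "leg0 C X m \<cdot> s = leg1 C X m" "leg1 C X m \<cdot> s = leg0 C X m"
    unfolding internal_symmetric_def by auto
  show "\<forall>u v. related X m u v \<longrightarrow> related X m v u"
  proof (intro allI impI)
    fix u v
    assume "related X m u v"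
    then obtain h where "h \<in> Arr C" "Cod C h = Dom C m" "leg0 C X m \<cdot> h = u" "leg1 C X m \<cdot> h = v"
      unfolding related_def by auto
    then show "related X m v u"
      using s m comp_extend[OF s(4), of h] comp_extend[OF s(5), of h]
      unfolding related_def by (intro bexI[of _ "s \<cdot> h"]) auto
  qed
next
  assume "\<forall>u v. related X m u v \<longrightarrow> related X m v u"
  then have "related X m (leg1 C X m) (leg0 C X m)"
    using related_legs[OF m] by blast
  then obtain s where s: "s \<in> Arr C" "Cod C s = Dom C m" "leg0 C X m \<cdot> s = leg1 C X m"
      "leg1 C X m \<cdot> s = leg0 C X m"
    unfolding related_def by auto
  have "Dom C s = Dom C m"
    using comp_eq_Dom[OF s(3)] s m by simp
  then show "internal_symmetric C X m"
    using s unfolding internal_symmetric_def by (intro bexI[of _ s]) auto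
qed

lemma internal_transitive_iff:
  assumes m: "internal_relation C X m"
  shows "internal_transitive C X m \<longleftrightarrow>
    (\<forall>u v w. related X m u v \<longrightarrow> related X m v w \<longrightarrow> related X m u w)"
proof
  assume tr: "internal_transitive C X m"
  show "\<forall>u v w. related X m u v \<longrightarrow> related X m v w \<longrightarrow> related X m u w"
  proof (intro allI impI)
    fix u v w
    assume uv: "related X m u v" and vw: "related X m v w"
    obtain h where h: "h \<in> Arr C" "Cod C h = Dom C m" "leg0 C X m \<cdot> h = u" "leg1 C X m \<cdot> h = v"
      using uv unfolding related_def by auto
    obtain k where k: "k \<in> Arr C" "Cod C k = Dom C m" "leg0 C X m \<cdot> k = v" "leg1 C X m \<cdot> k = w"
      using vw unfolding related_def by auto
    obtain p q where pq: "is_pullback C (leg1 C X m) (leg0 C X m) p q"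
      using pullback_exists[of "leg1 C X m" "leg0 C X m"] m by auto
    note pqA = is_pullbackD[OF pq]
    obtain t where t: "t \<in> Arr C" "Dom C t = Dom C p" "Cod C t = Dom C m"
        "leg0 C X m \<cdot> t = leg0 C X m \<cdot> p" "leg1 C X m \<cdot> t = leg1 C X m \<cdot> q"
      using tr pq unfolding internal_transitive_def by (fastforce)
    have "Dom C h = Dom C k"
      using comp_eq_Dom[OF h(4)] comp_eq_Dom[OF k(3)] h k m by simp
    then obtain l where l: "l \<in> Arr C" "Cod C l = Dom C p" "p \<cdot> l = h" "q \<cdot> l = k"
      using pullback_factor[OF pq, of h k "Dom C k"] h k m by auto
    show "related X m u w"
      using t l h k m pqA comp_extend[OF t(4), of l] comp_extend[OF t(5), of l]
      unfolding related_def by (intro bexI[of _ "t \<cdot> l"]) auto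
  qed
next
  assume tr: "\<forall>u v w. related X m u v \<longrightarrow> related X m v w \<longrightarrow> related X m u w"
  show "internal_transitive C X m"
    unfolding internal_transitive_def
  proof (intro allI impI)
    fix p q
    assume pq: "is_pullback C (leg1 C X m) (leg0 C X m) p q"
    note pqA = is_pullbackD[OF pq]
    have "related X m (leg0 C X m \<cdot> p) (leg1 C X m \<cdot> p)" "related X m (leg0 C X m \<cdot> q) (leg1 C X m \<cdot> q)"
      by (rule related_precomp[OF m related_legs[OF m]]; use pqA m in simp)+
    \<comment> \<open>The pullback equation identifies the end of the first pair with the start of
      the second, which gives the generic composable pair.\<close>
    then have "related X m (leg0 C X m \<cdot> p) (leg1 C X m \<cdot> q)"
      using tr unfolding pqA(9) by blast
    then obtain t where t: "t \<in> Arr C" "Cod C t = Dom C m" "leg0 C X m \<cdot> t = leg0 C X m \<cdot> p"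
        "leg1 C X m \<cdot> t = leg1 C X m \<cdot> q"
      unfolding related_def by auto
    have "Dom C t = Dom C p"
      using comp_eq_Dom[OF t(3)] t pqA m by simp
    then show "\<exists>t\<in>Hom C (Dom C p) (Dom C m).
        leg0 C X m \<cdot> t = leg0 C X m \<cdot> p \<and> leg1 C X m \<cdot> t = leg1 C X m \<cdot> q"
      using t by (intro bexI[of _ t]) auto
  qed
qed

text \<open>The legs are jointly monic, so uniqueness in the pullback property is automatic and only
  the generalized elements have to be compared.\<close>

lemma kernel_pair_legs_iff:
  assumes m: "internal_relation C X m"
  shows "is_kernel_pair C f (leg0 C X m) (leg1 C X m) \<longleftrightarrow>
    f \<in> Arr C \<and> Dom C f = X \<and> (\<forall>u v. related X m u v \<longleftrightarrow> parallel X u v \<and> f \<cdot> u = f \<cdot> v)"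
proof
  assume "is_kernel_pair C f (leg0 C X m) (leg1 C X m)"
  then have pb: "is_pullback C f f (leg0 C X m) (leg1 C X m)"
    unfolding is_kernel_pair_def .
  have f: "f \<in> Arr C" "Dom C f = X"
    using is_pullbackD[OF pb] m by auto
  have "related X m u v \<longleftrightarrow> parallel X u v \<and> f \<cdot> u = f \<cdot> v" for u v
  proof
    assume uv: "related X m u v"
    then obtain h where "h \<in> Arr C" "Cod C h = Dom C m" "leg0 C X m \<cdot> h = u" "leg1 C X m \<cdot> h = v"
      unfolding related_def by auto
    then show "parallel X u v \<and> f \<cdot> u = f \<cdot> v"
      using relatedD(1)[OF m uv] comp_extend[OF is_pullbackD(9)[OF pb], of h] f m by auto
  next
    assume "parallel X u v \<and> f \<cdot> u = f \<cdot> v"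
    then obtain h where "h \<in> Arr C" "Cod C h = Dom C m" "leg0 C X m \<cdot> h = u" "leg1 C X m \<cdot> h = v"
      using pullback_factor[OF pb, of u v "Dom C v"] f m unfolding parallel_def by auto
    then show "related X m u v"
      unfolding related_def by auto
  qed
  with f show "f \<in> Arr C \<and> Dom C f = X \<and>
      (\<forall>u v. related X m u v \<longleftrightarrow> parallel X u v \<and> f \<cdot> u = f \<cdot> v)"
    by blast
next
  assume "f \<in> Arr C \<and> Dom C f = X \<and>
    (\<forall>u v. related X m u v \<longleftrightarrow> parallel X u v \<and> f \<cdot> u = f \<cdot> v)"
  then have f: "f \<in> Arr C" "Dom C f = X"
    and rel: "\<And>u v. related X m u v \<longleftrightarrow> parallel X u v \<and> f \<cdot> u = f \<cdot> v"
    by auto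
  show "is_kernel_pair C f (leg0 C X m) (leg1 C X m)"
    unfolding is_kernel_pair_def is_pullback_def
  proof (intro conjI ballI impI)
    show "f \<cdot> leg0 C X m = f \<cdot> leg1 C X m"
      using related_legs[OF m] rel by blast
  next
    fix T u v
    assume u: "u \<in> Hom C T (Dom C f)" and v: "v \<in> Hom C T (Dom C f)" and eq: "f \<cdot> u = f \<cdot> v"
    then have "related X m u v"
      using rel f unfolding parallel_def by auto
    then obtain h where h: "h \<in> Arr C" "Cod C h = Dom C m" "leg0 C X m \<cdot> h = u" "leg1 C X m \<cdot> h = v"
      unfolding related_def by auto
    have "Dom C h = T"
      using comp_eq_Dom[OF h(3)] h u m by simp
    then show "\<exists>!h. h \<in> Hom C T (Dom C (leg0 C X m)) \<and> leg0 C X m \<cdot> h = u \<and> leg1 C X m \<cdot> h = v"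
      using h m legs_jointly_monic[OF m] by (intro ex1I[of _ h]) auto
  qed (use f m in auto)
qed

text \<open>Common source of the kernel, meet and composite relations: the span
  \<open>(f, g)\<close> is paired into the square and replaced by its image. Lifting along the
  regular epic part accounts for the cover in the description of its elements.\<close>

lemma image_relation_exists:
  assumes ar: "f \<in> Arr C" "g \<in> Arr C" "Dom C f = P" "Dom C g = P" "Cod C f = X" "Cod C g = X"
  obtains m where "internal_relation C X m"
    "\<And>u v. related X m u v \<longleftrightarrow> parallel X u v \<and>
       (\<exists>T c z. cover c T (Dom C u) \<and> z \<in> Arr C \<and> Cod C z = P \<and> f \<cdot> z = u \<cdot> c \<and> g \<cdot> z = v \<cdot> c)"
proof -
  have X: "X \<in> Obj C"
    using ar by auto
  have "parallel X f g"
    using ar unfolding parallel_def by auto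
  from ex1_implies_ex[OF square_ex1[OF X this]]
  obtain n where n: "n \<in> Arr C" "Dom C n = P" "Cod C n = square C X"
      "fst (square_proj C X) \<cdot> n = f" "snd (square_proj C X) \<cdot> n = g"
    using ar by auto
  obtain e m where em: "regular_epi C e" "is_mono C m" "Dom C e = Dom C n" "Cod C e = Dom C m"
    "Cod C m = Cod C n" "m \<cdot> e = n"
    using image_factorization[OF n(1)] by blast
  have m: "internal_relation C X m"
    using em n X unfolding internal_relation_def by auto
  have mA: "m \<in> Arr C"
    using m by simp
  have le: "leg0 C X m \<cdot> e = f" "leg1 C X m \<cdot> e = g"
    using em n X mA unfolding leg0_def leg1_def by auto
  have "related X m u v \<longleftrightarrow> parallel X u v \<and>
       (\<exists>T c z. cover c T (Dom C u) \<and> z \<in> Arr C \<and> Cod C z = P \<and> f \<cdot> z = u \<cdot> c \<and> g \<cdot> z = v \<cdot> c)"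
    (is "_ \<longleftrightarrow> _ \<and> ?ex u v") for u v
  proof (intro iffI conjI)
    assume uv: "related X m u v"
    then show "parallel X u v"
      using relatedD[OF m] by blast
    obtain h where h: "h \<in> Arr C" "Cod C h = Dom C m" "leg0 C X m \<cdot> h = u" "leg1 C X m \<cdot> h = v"
      using uv unfolding related_def by auto
    have hu: "Dom C h = Dom C u"
      using h m by auto
    obtain T c z where c: "cover c T (Dom C u)" and z: "z \<in> Arr C" "Dom C z = T" "Cod C z = Dom C e"
        "e \<cdot> z = h \<cdot> c"
      by (rule regular_epi_lift[OF em(1), of h "Dom C u"]) (use h hu em in auto)
    note cA = coverD[OF c]
    have "f \<cdot> z = u \<cdot> c" "g \<cdot> z = v \<cdot> c"
      using comp_extend[OF le(1), of z] comp_extend[OF le(2), of z] comp_extend[OF h(3), of c]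
        comp_extend[OF h(4), of c] z h hu cA em m by auto
    then show "?ex u v"
      using c z em n by auto
  next
    assume "parallel X u v \<and> ?ex u v"
    then obtain T c z where uv: "parallel X u v" and c: "cover c T (Dom C u)"
      and z: "z \<in> Arr C" "Cod C z = P" "f \<cdot> z = u \<cdot> c" "g \<cdot> z = v \<cdot> c"
      by blast
    have "related X m (u \<cdot> c) (v \<cdot> c)"
      using z em n m comp_extend[OF le(1), of z] comp_extend[OF le(2), of z]
      unfolding related_def by (intro bexI[of _ "e \<cdot> z"]) auto
    then show "related X m u v"
      using related_local[OF m uv c] by blast
  qed
  with that m show ?thesis
    by blast
qed

text \<open>A kernel pair comes as a span, whereas a relation is a monomorphism into the chosen
  square, so the image of the span is taken. The cover then disappears because an equation between
  arrows may be checked after a regular epimorphism.\<close>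

lemma kernel_relation_exists:
  assumes f: "f \<in> Arr C" "Dom C f = X"
  obtains m where "internal_relation C X m"
    "\<And>u v. related X m u v \<longleftrightarrow> parallel X u v \<and> f \<cdot> u = f \<cdot> v"
proof -
  obtain p q where pq: "is_pullback C f f p q"
    using pullback_exists[of f f] f by auto
  note pqA = is_pullbackD[OF pq]
  obtain m where m: "internal_relation C X m"
    and rel: "\<And>u v. related X m u v \<longleftrightarrow> parallel X u v \<and>
       (\<exists>T c z. cover c T (Dom C u) \<and> z \<in> Arr C \<and> Cod C z = Dom C p \<and> p \<cdot> z = u \<cdot> c \<and> q \<cdot> z = v \<cdot> c)"
    by (rule image_relation_exists[of p q "Dom C p" X]) (use pqA f in auto)
  have "related X m u v \<longleftrightarrow> parallel X u v \<and> f \<cdot> u = f \<cdot> v" for u v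
  proof
    assume uv: "related X m u v"
    then obtain T c z where c: "cover c T (Dom C u)" and z: "z \<in> Arr C" "Cod C z = Dom C p"
        "p \<cdot> z = u \<cdot> c" "q \<cdot> z = v \<cdot> c"
      using rel by blast
    note uvA = relatedD[OF m uv] and cA = coverD[OF c]
    have "(f \<cdot> u) \<cdot> c = (f \<cdot> v) \<cdot> c"
      using comp_extend[OF pqA(9), of z] z uvA cA pqA f by simp
    then have "f \<cdot> u = f \<cdot> v"
      by (rule regular_epi_cancel[OF cA(1), rotated -1]) (use uvA cA f in auto)
    with uvA show "parallel X u v \<and> f \<cdot> u = f \<cdot> v"
      by blast
  next
    assume uv: "parallel X u v \<and> f \<cdot> u = f \<cdot> v"
    then have uvA: "u \<in> Arr C" "v \<in> Arr C" "Dom C v = Dom C u" "Cod C u = X" "Cod C v = X"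
      unfolding parallel_def by auto
    obtain k where k: "k \<in> Arr C" "Dom C k = Dom C u" "Cod C k = Dom C p" "p \<cdot> k = u" "q \<cdot> k = v"
      by (rule pullback_factor[OF pq, of u v "Dom C u"]) (use uv uvA f in auto)
    have "cover (Ident C (Dom C u)) (Dom C u) (Dom C u)"
      using uvA split_epi_regular[of "Ident C (Dom C u)" "Ident C (Dom C u)"]
      unfolding cover_def by auto
    moreover have "p \<cdot> k = u \<cdot> Ident C (Dom C u)" "q \<cdot> k = v \<cdot> Ident C (Dom C u)"
      using k uvA by auto
    ultimately show "related X m u v"
      using uv k rel by blast
  qed
  with that m show ?thesis
    by blast
qed

text \<open>The intersection is the pullback of the two monomorphisms, viewed as a span on
  \<open>X\<close>. Membership in both descends from the cover, so no cover remains.\<close>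

lemma meet_relation_exists:
  assumes m: "internal_relation C X m" and n: "internal_relation C X n"
  obtains k where "internal_relation C X k"
    "\<And>u v. related X k u v \<longleftrightarrow> related X m u v \<and> related X n u v"
proof -
  have mn: "m \<in> Arr C" "n \<in> Arr C" "Cod C m = Cod C n"
    using m n unfolding internal_relation_def is_mono_def by auto
  obtain p q where pq: "is_pullback C m n p q"
    using pullback_exists[OF mn] by auto
  note pqA = is_pullbackD[OF pq]
  have legs_eq: "leg0 C X m \<cdot> p = leg0 C X n \<cdot> q" "leg1 C X m \<cdot> p = leg1 C X n \<cdot> q"
    using pqA m n unfolding leg0_def leg1_def internal_relation_def by auto
  have span: "leg0 C X m \<cdot> p \<in> Arr C" "leg1 C X m \<cdot> p \<in> Arr C" "Dom C (leg0 C X m \<cdot> p) = Dom C p"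
      "Dom C (leg1 C X m \<cdot> p) = Dom C p" "Cod C (leg0 C X m \<cdot> p) = X" "Cod C (leg1 C X m \<cdot> p) = X"
    using m pqA by simp_all
  obtain k where k: "internal_relation C X k"
    and rel: "\<And>u v. related X k u v \<longleftrightarrow> parallel X u v \<and>
       (\<exists>T c z. cover c T (Dom C u) \<and> z \<in> Arr C \<and> Cod C z = Dom C p \<and>
          (leg0 C X m \<cdot> p) \<cdot> z = u \<cdot> c \<and> (leg1 C X m \<cdot> p) \<cdot> z = v \<cdot> c)"
    by (rule image_relation_exists[OF span]) (rule that)
  have "related X k u v \<longleftrightarrow> related X m u v \<and> related X n u v" for u v
  proof (intro iffI)
    assume uv: "related X k u v"
    then obtain T c z where c: "cover c T (Dom C u)" and z: "z \<in> Arr C" "Cod C z = Dom C p"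
        "(leg0 C X m \<cdot> p) \<cdot> z = u \<cdot> c" "(leg1 C X m \<cdot> p) \<cdot> z = v \<cdot> c"
      using rel by blast
    have "related X m (u \<cdot> c) (v \<cdot> c)"
      using z m pqA unfolding related_def by (intro bexI[of _ "p \<cdot> z"]) auto
    moreover have "related X n (u \<cdot> c) (v \<cdot> c)"
      using z[unfolded legs_eq] n pqA unfolding related_def by (intro bexI[of _ "q \<cdot> z"]) auto
    ultimately show "related X m u v \<and> related X n u v"
      using related_local[OF m _ c] related_local[OF n _ c] relatedD(1)[OF k uv] by blast
  next
    assume uv: "related X m u v \<and> related X n u v"
    then obtain h where h: "h \<in> Arr C" "Cod C h = Dom C m" "leg0 C X m \<cdot> h = u" "leg1 C X m \<cdot> h = v"
      unfolding related_def by auto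
    obtain l where l: "l \<in> Arr C" "Cod C l = Dom C n" "leg0 C X n \<cdot> l = u" "leg1 C X n \<cdot> l = v"
      using uv unfolding related_def by auto
    have uvA: "parallel X u v" "u \<in> Arr C" "v \<in> Arr C" "Dom C v = Dom C u" "Dom C h = Dom C u" "Dom C l = Dom C u"
      using comp_eq_Dom[OF h(3)] comp_eq_Dom[OF l(3)] h(1,2) l(1,2) m n relatedD[OF m, of u v] uv by simp_all
    have X: "X \<in> Obj C"
      using m by simp
    have cod: "Cod C m = square C X" "Cod C n = square C X"
      using m n unfolding internal_relation_def by simp_all
    have eq: "leg0 C X m \<cdot> h = leg0 C X n \<cdot> l" "leg1 C X m \<cdot> h = leg1 C X n \<cdot> l"
      by (simp_all add: h l)
    have "m \<cdot> h = n \<cdot> l"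
      by (rule square_eq[OF X]) (use eq h(1,2) l(1,2) mn(1,2) cod X in \<open>simp_all add: leg0_def leg1_def\<close>)
    then obtain t where t: "t \<in> Arr C" "Cod C t = Dom C p" "p \<cdot> t = h" "q \<cdot> t = l"
      using pullback_factor[OF pq, of h l "Dom C u"] h l uvA by auto
    have "cover (Ident C (Dom C u)) (Dom C u) (Dom C u)"
      using uvA split_epi_regular[of "Ident C (Dom C u)" "Ident C (Dom C u)"]
      unfolding cover_def by auto
    moreover have "(leg0 C X m \<cdot> p) \<cdot> t = u \<cdot> Ident C (Dom C u)"
       "(leg1 C X m \<cdot> p) \<cdot> t = v \<cdot> Ident C (Dom C u)"
      using t h uvA m pqA by auto
    ultimately show "related X k u v"
      using uvA(1) t rel by blast
  qed
  with that k show ?thesis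
    by blast
qed

text \<open>The composable pairs form a pullback whose outer legs are not jointly monic in general;
  the image repairs this, and is why the middle element exists only locally.\<close>

lemma comp_relation_exists:
  assumes m: "internal_relation C X m" and n: "internal_relation C X n"
  obtains k where "internal_relation C X k" "\<And>u v. related X k u v \<longleftrightarrow> related_comp X m n u v"
proof -
  obtain p q where pq: "is_pullback C (leg1 C X m) (leg0 C X n) p q"
    using pullback_exists[of "leg1 C X m" "leg0 C X n"] m n by auto
  note pqA = is_pullbackD[OF pq]
  have span: "leg0 C X m \<cdot> p \<in> Arr C" "leg1 C X n \<cdot> q \<in> Arr C" "Dom C (leg0 C X m \<cdot> p) = Dom C p"
      "Dom C (leg1 C X n \<cdot> q) = Dom C p" "Cod C (leg0 C X m \<cdot> p) = X" "Cod C (leg1 C X n \<cdot> q) = X"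
    using m n pqA by simp_all
  obtain k where k: "internal_relation C X k"
    and rel: "\<And>u v. related X k u v \<longleftrightarrow> parallel X u v \<and>
       (\<exists>T c z. cover c T (Dom C u) \<and> z \<in> Arr C \<and> Cod C z = Dom C p \<and>
          (leg0 C X m \<cdot> p) \<cdot> z = u \<cdot> c \<and> (leg1 C X n \<cdot> q) \<cdot> z = v \<cdot> c)"
    by (rule image_relation_exists[OF span]) (rule that)
  have "(\<exists>z. z \<in> Arr C \<and> Cod C z = Dom C p \<and>
       (leg0 C X m \<cdot> p) \<cdot> z = u \<and> (leg1 C X n \<cdot> q) \<cdot> z = v) \<longleftrightarrow>
     (\<exists>y. related X m u y \<and> related X n y v)" for u v
  proof
    assume "\<exists>z. z \<in> Arr C \<and> Cod C z = Dom C p \<and>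
       (leg0 C X m \<cdot> p) \<cdot> z = u \<and> (leg1 C X n \<cdot> q) \<cdot> z = v"
    then obtain z where z: "z \<in> Arr C" "Cod C z = Dom C p"
        "(leg0 C X m \<cdot> p) \<cdot> z = u" "(leg1 C X n \<cdot> q) \<cdot> z = v"
      by blast
    have "related X m u (leg1 C X m \<cdot> (p \<cdot> z))"
      using z m pqA unfolding related_def by (intro bexI[of _ "p \<cdot> z"]) auto
    moreover have "related X n (leg1 C X m \<cdot> (p \<cdot> z)) v"
      using z m n pqA comp_extend[OF pqA(9), of z]
      unfolding related_def by (intro bexI[of _ "q \<cdot> z"]) auto
    ultimately show "\<exists>y. related X m u y \<and> related X n y v"
      by blast
  next
    assume "\<exists>y. related X m u y \<and> related X n y v"
    then obtain y where uy: "related X m u y" and yv: "related X n y v"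
      by blast
    obtain h where h: "h \<in> Arr C" "Cod C h = Dom C m" "leg0 C X m \<cdot> h = u" "leg1 C X m \<cdot> h = y"
      using uy unfolding related_def by auto
    obtain l where l: "l \<in> Arr C" "Cod C l = Dom C n" "leg0 C X n \<cdot> l = y" "leg1 C X n \<cdot> l = v"
      using yv unfolding related_def by auto
    have "Dom C h = Dom C l"
      using comp_eq_Dom[OF h(4)] comp_eq_Dom[OF l(3)] h l m n by simp
    then obtain t where t: "t \<in> Arr C" "Cod C t = Dom C p" "p \<cdot> t = h" "q \<cdot> t = l"
      using pullback_factor[OF pq, of h l "Dom C l"] h l m n by auto
    then show "\<exists>z. z \<in> Arr C \<and> Cod C z = Dom C p \<and>
       (leg0 C X m \<cdot> p) \<cdot> z = u \<and> (leg1 C X n \<cdot> q) \<cdot> z = v"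
      using h l m n pqA by (intro exI[of _ t]) auto
  qed
  \<comment> \<open>The equivalence for spans is used at the stage of the cover, with
    \<open>u \<cdot> c\<close> and \<open>v \<cdot> c\<close> in place of \<open>u\<close> and
    \<open>v\<close>.\<close>
  then have "related X k u v \<longleftrightarrow> related_comp X m n u v" for u v
    unfolding rel related_comp_def by metis
  with that k show ?thesis
    by blast
qed

section \<open>Equivalence relations\<close>

lemma internal_equivalenceI:
  assumes "internal_relation C X m"
    and "\<And>u. u \<in> Arr C \<Longrightarrow> Cod C u = X \<Longrightarrow> related X m u u"
    and "\<And>u v. related X m u v \<Longrightarrow> related X m v u"
    and "\<And>u v w. related X m u v \<Longrightarrow> related X m v w \<Longrightarrow> related X m u w"
  shows "internal_equivalence C X m"
  unfolding internal_equivalence_def internal_reflexive_iff[OF assms(1)]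
    internal_symmetric_iff[OF assms(1)] internal_transitive_iff[OF assms(1)]
  by (intro conjI allI ballI impI) (fact assms)+

lemma internal_equivalenceD:
  assumes "internal_equivalence C X m"
  shows "internal_relation C X m"
    and "u \<in> Arr C \<Longrightarrow> Cod C u = X \<Longrightarrow> related X m u u"
    and "related X m u v \<Longrightarrow> related X m v u"
    and "related X m u v \<Longrightarrow> related X m v w \<Longrightarrow> related X m u w"
proof -
  show m: "internal_relation C X m"
    using assms unfolding internal_equivalence_def by (rule conjunct1)
  have "(\<forall>u\<in>Arr C. Cod C u = X \<longrightarrow> related X m u u) \<and> (\<forall>u v. related X m u v \<longrightarrow> related X m v u) \<and>
      (\<forall>u v w. related X m u v \<longrightarrow> related X m v w \<longrightarrow> related X m u w)"
    using assms unfolding internal_equivalence_def internal_reflexive_iff[OF m]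
      internal_symmetric_iff[OF m] internal_transitive_iff[OF m] by (rule conjunct2)
  then show "u \<in> Arr C \<Longrightarrow> Cod C u = X \<Longrightarrow> related X m u u"
    and "related X m u v \<Longrightarrow> related X m v u"
    and "related X m u v \<Longrightarrow> related X m v w \<Longrightarrow> related X m u w"
    by blast+
qed

lemma kernel_relation_equivalence:
  assumes m: "internal_relation C X m" and f: "f \<in> Arr C" "Dom C f = X"
    and rel: "\<And>u v. related X m u v \<longleftrightarrow> parallel X u v \<and> f \<cdot> u = f \<cdot> v"
  shows "internal_equivalence C X m"
  by (rule internal_equivalenceI[OF m]) (auto simp: rel parallel_def)

lemma coequalizes_related:
  assumes m: "internal_relation C X m" and c: "c \<in> Arr C" "Dom C c = X"
    and eq: "c \<cdot> leg0 C X m = c \<cdot> leg1 C X m" and uv: "related X m u v"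
  shows "c \<cdot> u = c \<cdot> v"
proof -
  obtain h where h: "h \<in> Arr C" "Cod C h = Dom C m" "leg0 C X m \<cdot> h = u" "leg1 C X m \<cdot> h = v"
    using uv unfolding related_def by auto
  then show ?thesis
    using comp_extend[OF eq, of h] m c by simp
qed

end

section \<open>The lattice of equivalence relations in a regular Mal'tsev category\<close>

context regular_cat
begin

lemma related_compE:
  assumes "related_comp X m n u v"
  obtains T c y where "cover c T (Dom C u)" "related X m (u \<cdot> c) y" "related X n y (v \<cdot> c)"
  using assms unfolding related_comp_def by blast

text \<open>Half of the join property: transitivity of \<open>k\<close> removes the middle element
  over the cover, and descent then removes the cover.\<close>

lemma related_comp_le:
  assumes k: "internal_equivalence C X k"
    and mk: "\<And>u v. related X m u v \<Longrightarrow> related X k u v"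
    and nk: "\<And>u v. related X n u v \<Longrightarrow> related X k u v"
    and uv: "related_comp X m n u v"
  shows "related X k u v"
proof -
  obtain T c y where c: "cover c T (Dom C u)" and y: "related X m (u \<cdot> c) y" "related X n y (v \<cdot> c)"
    using uv by (rule related_compE)
  have "parallel X u v"
    using uv unfolding related_comp_def by blast
  then show ?thesis
    using related_local[OF internal_equivalenceD(1)[OF k] _ c] internal_equivalenceD(4)[OF k mk[OF y(1)] nk[OF y(2)]]
    by blast
qed

end

locale regular_maltsev_cat = regular_cat C for C :: "('o, 'a) cat_data" (structure) +
  assumes maltsev: "maltsev_category C"
begin

lemma reflexive_relation_equivalence:
  assumes "internal_relation C X m" "\<And>u. u \<in> Arr C \<Longrightarrow> Cod C u = X \<Longrightarrow> related X m u u"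
  shows "internal_equivalence C X m"
  using maltsev assms internal_reflexive_iff[OF assms(1)] unfolding maltsev_category_def by blast

lemma meet_equivalence_exists:
  assumes m: "internal_equivalence C X m" and n: "internal_equivalence C X n"
  obtains k where "internal_equivalence C X k"
    "\<And>u v. related X k u v \<longleftrightarrow> related X m u v \<and> related X n u v"
proof -
  obtain k where k: "internal_relation C X k"
    and rel: "\<And>u v. related X k u v \<longleftrightarrow> related X m u v \<and> related X n u v"
    using meet_relation_exists[OF internal_equivalenceD(1)[OF m] internal_equivalenceD(1)[OF n]] by blast
  have "internal_equivalence C X k"
    using internal_equivalenceD(2)[OF m] internal_equivalenceD(2)[OF n]
    by (intro reflexive_relation_equivalence[OF k]) (simp add: rel)
  with that rel show ?thesis
    by blast
qed

text \<open>Each factor lies in the composite because the other factor is reflexive. So the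
  composite is reflexive, and the Mal'tsev property supplies symmetry and transitivity.\<close>

lemma comp_equivalence_exists:
  assumes m: "internal_equivalence C X m" and n: "internal_equivalence C X n"
  obtains k where "internal_equivalence C X k" "\<And>u v. related X k u v \<longleftrightarrow> related_comp X m n u v"
    "\<And>u v. related X m u v \<Longrightarrow> related X k u v" "\<And>u v. related X n u v \<Longrightarrow> related X k u v"
proof -
  note m' = internal_equivalenceD(1)[OF m] and n' = internal_equivalenceD(1)[OF n]
  obtain k where k: "internal_relation C X k"
    and rel: "\<And>u v. related X k u v \<longleftrightarrow> related_comp X m n u v"
    using comp_relation_exists[OF m' n'] by blast
  have mk: "related X k u v" if "related X m u v" for u v
    using related_comp_intro[OF m' n' that internal_equivalenceD(2)[OF n]] relatedD[OF m' that] rel by blast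
  have nk: "related X k u v" if "related X n u v" for u v
    using related_comp_intro[OF m' n' internal_equivalenceD(2)[OF m] that] relatedD[OF n' that] rel by blast
  have "internal_equivalence C X k"
    using internal_equivalenceD(2)[OF m] mk by (intro reflexive_relation_equivalence[OF k]) blast
  with that rel mk nk show ?thesis
    by blast
qed

lemma Equiv_simps:
  "x \<in> carrier (Equiv C X) \<longleftrightarrow> internal_equivalence C X x"
  "x .=\<^bsub>Equiv C X\<^esub> y \<longleftrightarrow> subobject_le C x y \<and> subobject_le C y x"
  "x \<sqsubseteq>\<^bsub>Equiv C X\<^esub> y \<longleftrightarrow> subobject_le C x y"
  unfolding Equiv_def by auto

lemma Equiv_le_iff:
  assumes "internal_equivalence C X x" "internal_equivalence C X y"
  shows "subobject_le C x y \<longleftrightarrow> (\<forall>u v. related X x u v \<longrightarrow> related X y u v)"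
  by (rule subobject_le_related) (rule internal_equivalenceD(1), fact)+

text \<open>The composite is the join: it contains both relations and lies below every equivalence
  relation containing them. The intersection is the meet. The order laws become logical tautologies
  once inclusion is expressed by elements.\<close>

lemma Equiv_weak_lattice: "weak_lattice (Equiv C X)"
proof unfold_locales
  fix x y
  assume "x \<in> carrier (Equiv C X)" "y \<in> carrier (Equiv C X)"
  then have x: "internal_equivalence C X x" and y: "internal_equivalence C X y"
    unfolding Equiv_simps .
  obtain k where k: "internal_equivalence C X k"
    and rel: "\<And>u v. related X k u v \<longleftrightarrow> related_comp X x y u v"
    and le: "\<And>u v. related X x u v \<Longrightarrow> related X k u v" "\<And>u v. related X y u v \<Longrightarrow> related X k u v"
    by (rule comp_equivalence_exists[OF x y]) (rule that)
  have "subobject_le C k z" if "internal_equivalence C X z" "subobject_le C x z" "subobject_le C y z" for z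
    using that related_comp_le[OF that(1)] Equiv_le_iff[OF k that(1)] Equiv_le_iff[OF x that(1)]
      Equiv_le_iff[OF y that(1)] rel by blast
  moreover have "subobject_le C x k" "subobject_le C y k"
    using le Equiv_le_iff[OF x k] Equiv_le_iff[OF y k] by blast+
  ultimately show "\<exists>s. least (Equiv C X) s (Upper (Equiv C X) {x, y})"
    using x y k by (intro exI[of _ k]) (auto simp: least_def Upper_def Equiv_simps)
next
  fix x y
  assume "x \<in> carrier (Equiv C X)" "y \<in> carrier (Equiv C X)"
  then have x: "internal_equivalence C X x" and y: "internal_equivalence C X y"
    unfolding Equiv_simps .
  obtain k where k: "internal_equivalence C X k"
    and rel: "\<And>u v. related X k u v \<longleftrightarrow> related X x u v \<and> related X y u v"
    using meet_equivalence_exists[OF x y] by blast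
  have "subobject_le C z k" if "internal_equivalence C X z" "subobject_le C z x" "subobject_le C z y" for z
    using that Equiv_le_iff[OF that(1) k] Equiv_le_iff[OF that(1) x] Equiv_le_iff[OF that(1) y] rel by blast
  moreover have "subobject_le C k x" "subobject_le C k y"
    using rel Equiv_le_iff[OF k x] Equiv_le_iff[OF k y] by blast+
  ultimately show "\<exists>s. greatest (Equiv C X) s (Lower (Equiv C X) {x, y})"
    using x y k by (intro exI[of _ k]) (auto simp: greatest_def Lower_def Equiv_simps)
next
  fix x y z
  assume "x \<in> carrier (Equiv C X)" "y \<in> carrier (Equiv C X)" "z \<in> carrier (Equiv C X)"
  then have xyz: "internal_equivalence C X x" "internal_equivalence C X y" "internal_equivalence C X z"
    unfolding Equiv_simps .
  note le = Equiv_le_iff[OF xyz(1,2)] Equiv_le_iff[OF xyz(2,3)] Equiv_le_iff[OF xyz(1,3)]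
    Equiv_le_iff[OF xyz(2,1)] Equiv_le_iff[OF xyz(3,2)] Equiv_le_iff[OF xyz(3,1)]
  show "x \<sqsubseteq>\<^bsub>Equiv C X\<^esub> y \<Longrightarrow> y \<sqsubseteq>\<^bsub>Equiv C X\<^esub> z \<Longrightarrow> x \<sqsubseteq>\<^bsub>Equiv C X\<^esub> z"
    and "x .=\<^bsub>Equiv C X\<^esub> y \<Longrightarrow> y .=\<^bsub>Equiv C X\<^esub> z \<Longrightarrow> x .=\<^bsub>Equiv C X\<^esub> z"
    unfolding Equiv_simps le by blast+
next
  fix x y z w
  assume "x .=\<^bsub>Equiv C X\<^esub> y" "z .=\<^bsub>Equiv C X\<^esub> w"
    and "x \<in> carrier (Equiv C X)" "y \<in> carrier (Equiv C X)" "z \<in> carrier (Equiv C X)"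
      "w \<in> carrier (Equiv C X)"
  moreover from this have e: "internal_equivalence C X x" "internal_equivalence C X y"
      "internal_equivalence C X z" "internal_equivalence C X w"
    unfolding Equiv_simps by blast+
  ultimately show "x \<sqsubseteq>\<^bsub>Equiv C X\<^esub> z \<longleftrightarrow> y \<sqsubseteq>\<^bsub>Equiv C X\<^esub> w"
    unfolding Equiv_simps Equiv_le_iff[OF e(1,2)] Equiv_le_iff[OF e(2,1)] Equiv_le_iff[OF e(3,4)]
      Equiv_le_iff[OF e(4,3)] Equiv_le_iff[OF e(1,3)] Equiv_le_iff[OF e(2,4)] by blast
next
  fix x
  assume "x \<in> carrier (Equiv C X)"
  then have x: "internal_equivalence C X x"
    unfolding Equiv_simps .
  show "x \<sqsubseteq>\<^bsub>Equiv C X\<^esub> x" "x .=\<^bsub>Equiv C X\<^esub> x"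
    unfolding Equiv_simps Equiv_le_iff[OF x x] by blast+
qed (unfold Equiv_simps, blast+)

text \<open>The lattice operation selects some greatest lower bound and is known only through its
  order properties. Comparing it with the constructed intersection \<open>k\<close> determines its
  elements.\<close>

lemma related_meet:
  assumes x: "internal_equivalence C X x" and y: "internal_equivalence C X y"
  shows "internal_equivalence C X (x \<sqinter>\<^bsub>Equiv C X\<^esub> y)"
    "related X (x \<sqinter>\<^bsub>Equiv C X\<^esub> y) u v \<longleftrightarrow> related X x u v \<and> related X y u v"
proof -
  interpret weak_lattice "Equiv C X"
    by (rule Equiv_weak_lattice)
  have xy: "x \<in> carrier (Equiv C X)" "y \<in> carrier (Equiv C X)"
    using x y unfolding Equiv_simps .
  show e: "internal_equivalence C X (x \<sqinter>\<^bsub>Equiv C X\<^esub> y)"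
    using meet_closed[OF xy] unfolding Equiv_simps .
  obtain k where k: "internal_equivalence C X k"
    and rel: "\<And>u v. related X k u v \<longleftrightarrow> related X x u v \<and> related X y u v"
    using meet_equivalence_exists[OF x y] by blast
  have "subobject_le C k x" "subobject_le C k y"
    using rel Equiv_le_iff[OF k x] Equiv_le_iff[OF k y] by blast+
  then have "subobject_le C k (x \<sqinter>\<^bsub>Equiv C X\<^esub> y)"
    using meet_le[of k x y] x y k unfolding Equiv_simps by blast
  moreover have "subobject_le C (x \<sqinter>\<^bsub>Equiv C X\<^esub> y) x" "subobject_le C (x \<sqinter>\<^bsub>Equiv C X\<^esub> y) y"
    using meet_left[OF xy] meet_right[OF xy] unfolding Equiv_simps .
  ultimately show "related X (x \<sqinter>\<^bsub>Equiv C X\<^esub> y) u v \<longleftrightarrow> related X x u v \<and> related X y u v"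
    using Equiv_le_iff[OF k e] Equiv_le_iff[OF e x] Equiv_le_iff[OF e y] rel by blast
qed

lemma related_join:
  assumes x: "internal_equivalence C X x" and y: "internal_equivalence C X y"
  shows "internal_equivalence C X (x \<squnion>\<^bsub>Equiv C X\<^esub> y)"
    "related X (x \<squnion>\<^bsub>Equiv C X\<^esub> y) u v \<longleftrightarrow> related_comp X x y u v"
proof -
  interpret weak_lattice "Equiv C X"
    by (rule Equiv_weak_lattice)
  have xy: "x \<in> carrier (Equiv C X)" "y \<in> carrier (Equiv C X)"
    using x y unfolding Equiv_simps .
  show e: "internal_equivalence C X (x \<squnion>\<^bsub>Equiv C X\<^esub> y)"
    using join_closed[OF xy] unfolding Equiv_simps .
  obtain k where k: "internal_equivalence C X k"
    and rel: "\<And>u v. related X k u v \<longleftrightarrow> related_comp X x y u v"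
    and le: "\<And>u v. related X x u v \<Longrightarrow> related X k u v" "\<And>u v. related X y u v \<Longrightarrow> related X k u v"
    by (rule comp_equivalence_exists[OF x y]) (rule that)
  have "subobject_le C x k" "subobject_le C y k"
    using le Equiv_le_iff[OF x k] Equiv_le_iff[OF y k] by blast+
  then have "subobject_le C (x \<squnion>\<^bsub>Equiv C X\<^esub> y) k"
    using join_le[of x k y] x y k unfolding Equiv_simps by blast
  moreover have "subobject_le C x (x \<squnion>\<^bsub>Equiv C X\<^esub> y)" "subobject_le C y (x \<squnion>\<^bsub>Equiv C X\<^esub> y)"
    using join_left[OF xy] join_right[OF xy] unfolding Equiv_simps .
  then have "related X (x \<squnion>\<^bsub>Equiv C X\<^esub> y) u v" if "related_comp X x y u v"
    using related_comp_le[OF e _ _ that] Equiv_le_iff[OF x e] Equiv_le_iff[OF y e] by blast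
  ultimately show "related X (x \<squnion>\<^bsub>Equiv C X\<^esub> y) u v \<longleftrightarrow> related_comp X x y u v"
    using Equiv_le_iff[OF e k] rel by blast
qed

text \<open>Only the inequality from left to right has content; the reverse one holds in any
  lattice. The middle element \<open>w\<close> should also satisfy that \<open>x\<close> relates
  \<open>w\<close> to \<open>v \<cdot> c\<close>, but this follows from the other memberships by
  symmetry and transitivity of \<open>x\<close>.\<close>

lemma distributive_lattice_iff:
  "distributive_lattice (Equiv C X) \<longleftrightarrow>
     (\<forall>x y z u v. internal_equivalence C X x \<longrightarrow> internal_equivalence C X y \<longrightarrow>
        internal_equivalence C X z \<longrightarrow> related X x u v \<longrightarrow> related_comp X y z u v \<longrightarrow>
        (\<exists>T c w. cover c T (Dom C u) \<and> related X x (u \<cdot> c) w \<and> related X y (u \<cdot> c) w \<and>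
           related X z w (v \<cdot> c)))" (is "_ \<longleftrightarrow> ?R")
proof
  assume d: "distributive_lattice (Equiv C X)"
  show ?R
  proof (intro allI impI)
    fix x y z u v
    assume x: "internal_equivalence C X x" and y: "internal_equivalence C X y"
      and z: "internal_equivalence C X z" and uv: "related X x u v" "related_comp X y z u v"
    note m = related_meet(1)[OF x y] and n = related_meet(1)[OF x z] and j = related_join(1)[OF y z]
    have "subobject_le C (x \<sqinter>\<^bsub>Equiv C X\<^esub> (y \<squnion>\<^bsub>Equiv C X\<^esub> z))
        ((x \<sqinter>\<^bsub>Equiv C X\<^esub> y) \<squnion>\<^bsub>Equiv C X\<^esub> (x \<sqinter>\<^bsub>Equiv C X\<^esub> z))"
      using d x y z unfolding distributive_lattice_def Equiv_simps(1)[symmetric] Equiv_simps(2) by blast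
    then have "related_comp X (x \<sqinter>\<^bsub>Equiv C X\<^esub> y) (x \<sqinter>\<^bsub>Equiv C X\<^esub> z) u v"
      using uv unfolding Equiv_le_iff[OF related_meet(1)[OF x j] related_join(1)[OF m n]]
        related_meet(2)[OF x j] related_join(2)[OF y z] related_join(2)[OF m n] by blast
    then show "\<exists>T c w. cover c T (Dom C u) \<and> related X x (u \<cdot> c) w \<and> related X y (u \<cdot> c) w \<and>
           related X z w (v \<cdot> c)"
      unfolding related_comp_def related_meet(2)[OF x y] related_meet(2)[OF x z] by blast
  qed
next
  assume R: ?R
  show "distributive_lattice (Equiv C X)"
    unfolding distributive_lattice_def
  proof (intro conjI ballI Equiv_weak_lattice)
    fix x y z
    assume "x \<in> carrier (Equiv C X)" "y \<in> carrier (Equiv C X)" "z \<in> carrier (Equiv C X)"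
    then have x: "internal_equivalence C X x" and y: "internal_equivalence C X y"
      and z: "internal_equivalence C X z"
      unfolding Equiv_simps .
    let ?m = "x \<sqinter>\<^bsub>Equiv C X\<^esub> y" and ?n = "x \<sqinter>\<^bsub>Equiv C X\<^esub> z" and ?j = "y \<squnion>\<^bsub>Equiv C X\<^esub> z"
    have m: "internal_equivalence C X ?m" and n: "internal_equivalence C X ?n"
      and j: "internal_equivalence C X ?j" 
      using related_meet(1)[OF x y] related_meet(1)[OF x z] related_join(1)[OF y z] .
    have l: "internal_equivalence C X (x \<sqinter>\<^bsub>Equiv C X\<^esub> ?j)"
      and r: "internal_equivalence C X (?m \<squnion>\<^bsub>Equiv C X\<^esub> ?n)"
      using related_meet(1)[OF x j] related_join(1)[OF m n] .
    have yj: "related X ?j u v" if "related X y u v" for u v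
      unfolding related_join(2)[OF y z]
      using related_comp_intro[OF internal_equivalenceD(1)[OF y] internal_equivalenceD(1)[OF z] that
        internal_equivalenceD(2)[OF z]] relatedD[OF internal_equivalenceD(1)[OF y] that] by blast
    have zj: "related X ?j u v" if "related X z u v" for u v
      unfolding related_join(2)[OF y z]
      using related_comp_intro[OF internal_equivalenceD(1)[OF y] internal_equivalenceD(1)[OF z]
        internal_equivalenceD(2)[OF y] that] relatedD[OF internal_equivalenceD(1)[OF z] that] by blast
    have "related X (x \<sqinter>\<^bsub>Equiv C X\<^esub> ?j) u v" if "related_comp X ?m ?n u v" for u v
      using related_comp_le[OF l _ _ that] yj zj
      unfolding related_meet(2)[OF x y] related_meet(2)[OF x z] related_meet(2)[OF x j] by blast
    then have "subobject_le C (?m \<squnion>\<^bsub>Equiv C X\<^esub> ?n) (x \<sqinter>\<^bsub>Equiv C X\<^esub> ?j)"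
      unfolding Equiv_le_iff[OF r l] related_join(2)[OF m n] by blast
    moreover have "related_comp X ?m ?n u v" if uv: "related X x u v" "related_comp X y z u v" for u v
    proof -
      obtain T c w where c: "cover c T (Dom C u)" and w: "related X x (u \<cdot> c) w" "related X y (u \<cdot> c) w"
          "related X z w (v \<cdot> c)"
        using R x y z uv by blast
      have "related X x (u \<cdot> c) (v \<cdot> c)"
        using related_precomp[OF internal_equivalenceD(1)[OF x] uv(1)] coverD[OF c] by blast
      then have "related X x w (v \<cdot> c)"
        using internal_equivalenceD(3,4)[OF x] w(1) by blast
      then show ?thesis
        using c w uv(2) unfolding related_comp_def related_meet(2)[OF x y] related_meet(2)[OF x z] by blast
    qed
    then have "subobject_le C (x \<sqinter>\<^bsub>Equiv C X\<^esub> ?j) (?m \<squnion>\<^bsub>Equiv C X\<^esub> ?n)"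
      unfolding Equiv_le_iff[OF l r] related_join(2)[OF m n] related_meet(2)[OF x j] related_join(2)[OF y z]
      by blast
    ultimately show "x \<sqinter>\<^bsub>Equiv C X\<^esub> ?j .=\<^bsub>Equiv C X\<^esub> ?m \<squnion>\<^bsub>Equiv C X\<^esub> ?n"
      unfolding Equiv_simps by blast
  qed
qed

section \<open>Pushouts of regular epimorphisms\<close>

lemma regular_epi_coequalizer_legs:
  assumes r: "regular_epi C r" "Dom C r = X" and m: "internal_relation C X m"
    and rel: "\<And>u v. related X m u v \<longleftrightarrow> parallel X u v \<and> r \<cdot> u = r \<cdot> v"
  shows "is_coequalizer C (leg0 C X m) (leg1 C X m) r"
  using coequalizer_kernel_pair[OF r(1)] kernel_pair_legs_iff[OF m, of r] r rel by simp

text \<open>Effectiveness gives some \<open>f\<close> with kernel pair \<open>k\<close>, not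
  necessarily an epimorphism. Its replacement \<open>c\<close> is the coequalizer of that kernel
  pair; since \<open>f\<close> factors through \<open>c\<close>, the arrow \<open>c\<close>
  identifies no more than \<open>f\<close> does.\<close>

lemma exact_quotient_exists:
  assumes exact: "exact_category C" and k: "internal_equivalence C X k"
  obtains c where "is_coequalizer C (leg0 C X k) (leg1 C X k) c" "regular_epi C c" "Dom C c = X"
    "\<And>u v. related X k u v \<longleftrightarrow> parallel X u v \<and> c \<cdot> u = c \<cdot> v"
proof -
  note k' = internal_equivalenceD(1)[OF k]
  obtain f where f: "is_kernel_pair C f (leg0 C X k) (leg1 C X k)"
    using exact k unfolding exact_category_def effective_def by blast
  then have fA: "f \<in> Arr C" "Dom C f = X"
    and frel: "\<And>u v. related X k u v \<longleftrightarrow> parallel X u v \<and> f \<cdot> u = f \<cdot> v"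
    unfolding kernel_pair_legs_iff[OF k'] by auto
  obtain c where c: "is_coequalizer C (leg0 C X k) (leg1 C X k) c"
    using f regular unfolding regular_category_def by blast
  then have cA: "c \<in> Arr C" "Dom C c = X" "c \<cdot> leg0 C X k = c \<cdot> leg1 C X k"
    using k' unfolding is_coequalizer_def by auto
  have "f \<cdot> leg0 C X k = f \<cdot> leg1 C X k"
    using related_legs[OF k'] frel by blast
  then obtain g where g: "g \<in> Arr C" "Dom C g = Cod C c" "g \<cdot> c = f"
    by (rule coequalizer_factor[OF c, of f, rotated 2]) (use fA k' in auto)
  have "related X k u v" if "parallel X u v" "c \<cdot> u = c \<cdot> v" for u v
  proof -
    have "f \<cdot> u = f \<cdot> v"
      using comp_extend[OF g(3), of u] comp_extend[OF g(3), of v] that g cA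
      unfolding parallel_def by simp
    then show ?thesis
      using that(1) frel by blast
  qed
  then have "related X k u v \<longleftrightarrow> parallel X u v \<and> c \<cdot> u = c \<cdot> v" for u v
    using coequalizes_related[OF k' cA] relatedD(1)[OF k'] by blast
  moreover have "regular_epi C c"
    using c unfolding regular_epi_def by blast
  ultimately show ?thesis
    using that c cA(2) by blast
qed

text \<open>The quotient of \<open>X\<close> by the composite of the kernel pairs is the pushout.\<close>

lemma exact_pushout_exists:
  assumes exact: "exact_category C"
    and r: "regular_epi C r" "Dom C r = X" and s: "regular_epi C s" "Dom C s = X"
    and m: "internal_relation C X m" and mrel: "\<And>u v. related X m u v \<longleftrightarrow> parallel X u v \<and> r \<cdot> u = r \<cdot> v"
    and n: "internal_relation C X n" and nrel: "\<And>u v. related X n u v \<longleftrightarrow> parallel X u v \<and> s \<cdot> u = s \<cdot> v"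
  obtains p q where "is_pushout C r s p q"
    "\<And>u v. parallel X u v \<Longrightarrow> p \<cdot> (r \<cdot> u) = q \<cdot> (s \<cdot> v) \<Longrightarrow> related_comp X m n u v"
proof -
  have rA: "r \<in> Arr C" and sA: "s \<in> Arr C"
    using r s by auto
  have me: "internal_equivalence C X m" and ne: "internal_equivalence C X n"
    using kernel_relation_equivalence[OF m rA r(2) mrel] kernel_relation_equivalence[OF n sA s(2) nrel] .
  obtain k where ke: "internal_equivalence C X k"
    and rel: "\<And>u v. related X k u v \<longleftrightarrow> related_comp X m n u v"
    and le: "\<And>u v. related X m u v \<Longrightarrow> related X k u v" "\<And>u v. related X n u v \<Longrightarrow> related X k u v"
    by (rule comp_equivalence_exists[OF me ne]) (rule that)
  note k = internal_equivalenceD(1)[OF ke]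
  obtain c where c: "is_coequalizer C (leg0 C X k) (leg1 C X k) c"
    and creg: "regular_epi C c" and cX: "Dom C c = X"
    and crel: "\<And>u v. related X k u v \<longleftrightarrow> parallel X u v \<and> c \<cdot> u = c \<cdot> v"
    using exact_quotient_exists[OF exact ke] by blast
  have cA: "c \<in> Arr C" "Dom C c = X"
    using creg cX by auto
  have c_eq: "c \<cdot> u = c \<cdot> v" if "related X k u v" for u v
    using that crel by blast
  obtain p where p: "p \<in> Arr C" "Dom C p = Cod C r" "Cod C p = Cod C c" "p \<cdot> r = c"
    using coequalizer_factor[OF regular_epi_coequalizer_legs[OF r m mrel] cA(1)]
      c_eq[OF le(1)[OF related_legs[OF m]]] cA m by auto
  obtain q where q: "q \<in> Arr C" "Dom C q = Cod C s" "Cod C q = Cod C c" "q \<cdot> s = c"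
    using coequalizer_factor[OF regular_epi_coequalizer_legs[OF s n nrel] cA(1)]
      c_eq[OF le(2)[OF related_legs[OF n]]] cA n by auto
  have "is_pushout C r s p q"
    unfolding is_pushout_def
  proof (intro conjI ballI impI)
    fix T u v
    assume u: "u \<in> Hom C (Cod C r) T" and v: "v \<in> Hom C (Cod C s) T" and eq: "u \<cdot> r = v \<cdot> s"
    \<comment> \<open>To show that \<open>u \<cdot> r\<close> equalizes the legs of
      \<open>k\<close>, the generic element of \<open>k\<close> is split locally at
      \<open>y\<close>: up to \<open>y\<close> the arrow \<open>u \<cdot> r\<close> is constant, and
      from \<open>y\<close> on \<open>v \<cdot> s\<close>, which is the same arrow.\<close>
    have "related_comp X m n (leg0 C X k) (leg1 C X k)"
      using related_legs[OF k] unfolding rel .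
    then obtain T' d y where d: "cover d T' (Dom C (leg0 C X k))"
      and y: "related X m (leg0 C X k \<cdot> d) y" "related X n y (leg1 C X k \<cdot> d)"
      by (rule related_compE)
    note dA = coverD[OF d]
    have y': "r \<cdot> (leg0 C X k \<cdot> d) = r \<cdot> y" "s \<cdot> y = s \<cdot> (leg1 C X k \<cdot> d)" "y \<in> Arr C" "Cod C y = X"
      using y mrel nrel unfolding parallel_def by auto
    have "((u \<cdot> r) \<cdot> leg0 C X k) \<cdot> d = u \<cdot> (r \<cdot> y)"
      using u rA r k dA y' by simp
    also have "\<dots> = v \<cdot> (s \<cdot> y)"
      using comp_extend[OF eq, of y] u v rA sA r s y' by simp
    also have "\<dots> = ((v \<cdot> s) \<cdot> leg1 C X k) \<cdot> d"
      using v sA s k dA y' by simp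
    also have "\<dots> = ((u \<cdot> r) \<cdot> leg1 C X k) \<cdot> d"
      by (simp only: eq)
    finally have "(u \<cdot> r) \<cdot> leg0 C X k = (u \<cdot> r) \<cdot> leg1 C X k"
      by (rule regular_epi_cancel[OF dA(1), rotated -1]) (use u rA r k dA in auto)
    then obtain h where h: "h \<in> Arr C" "Dom C h = Cod C c" "Cod C h = T" "h \<cdot> c = u \<cdot> r"
      by (rule coequalizer_factor[OF c, of "u \<cdot> r", rotated 2]) (use u rA r k in auto)
    have "h \<cdot> p = u"
      by (rule regular_epi_cancel[OF r(1)]) (use h p rA u in auto)
    moreover have "h \<cdot> q = v"
      by (rule regular_epi_cancel[OF s(1)]) (use h q sA v eq in auto)
    \<comment> \<open>Both candidates give \<open>u \<cdot> r\<close> when composed with the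
      epimorphism \<open>c\<close>, which equals \<open>p \<cdot> r\<close>.\<close>
    moreover have "h' = h" if "h' \<in> Hom C (Cod C p) T" "h' \<cdot> p = u" for h'
      by (rule regular_epi_cancel[OF creg]) (use h that p comp_extend[OF that(2), of r] rA in auto)
    moreover have "h \<in> Hom C (Cod C p) T"
      using h p by simp
    ultimately show "\<exists>!h. h \<in> Hom C (Cod C p) T \<and> h \<cdot> p = u \<and> h \<cdot> q = v"
      by blast
  qed (use rA sA r s p q in auto)
  moreover have "related_comp X m n u v" if uv: "parallel X u v" and eq: "p \<cdot> (r \<cdot> u) = q \<cdot> (s \<cdot> v)" for u v
  proof -
    have uvA: "u \<in> Arr C" "v \<in> Arr C" "Cod C u = X" "Cod C v = X"
      using uv unfolding parallel_def by auto
    have cuv: "c \<cdot> u = c \<cdot> v"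
      using eq comp_extend[OF p(4), of u] comp_extend[OF q(4), of v] uvA p q rA sA r s by simp
    then show ?thesis
      using uv crel rel by blast
  qed
  ultimately show ?thesis
    using that by blast
qed

text \<open>Transfers the description of the constructed pushout to an arbitrary one: the comparison
  arrow \<open>h\<close> carries the given equation to the constructed pushout, where its meaning is
  known.\<close>

lemma exact_pushout_related_comp:
  assumes exact: "exact_category C"
    and r: "regular_epi C r" "Dom C r = X" and s: "regular_epi C s" "Dom C s = X"
    and m: "internal_relation C X m" and mrel: "\<And>u v. related X m u v \<longleftrightarrow> parallel X u v \<and> r \<cdot> u = r \<cdot> v"
    and n: "internal_relation C X n" and nrel: "\<And>u v. related X n u v \<longleftrightarrow> parallel X u v \<and> s \<cdot> u = s \<cdot> v"
    and po: "is_pushout C r s p q" and uv: "parallel X u v" and eq: "p \<cdot> (r \<cdot> u) = q \<cdot> (s \<cdot> v)"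
  shows "related_comp X m n u v"
proof -
  obtain p' q' where po': "is_pushout C r s p' q'"
    and rc: "\<And>u v. parallel X u v \<Longrightarrow> p' \<cdot> (r \<cdot> u) = q' \<cdot> (s \<cdot> v) \<Longrightarrow> related_comp X m n u v"
    using exact_pushout_exists[OF exact r s m mrel n nrel] by blast
  have rA: "r \<in> Arr C" and sA: "s \<in> Arr C"
    using r s by auto
  have uvA: "u \<in> Arr C" "v \<in> Arr C" "Cod C u = X" "Cod C v = X"
    using uv unfolding parallel_def by auto
  have pA: "p \<in> Arr C" "Dom C p = Cod C r" "q \<in> Arr C" "Dom C q = Cod C s" "Cod C q = Cod C p"
    using po unfolding is_pushout_def by auto
  have p': "Cod C p' \<in> Obj C" "p' \<in> Hom C (Cod C r) (Cod C p')" "q' \<in> Hom C (Cod C s) (Cod C p')"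
      "p' \<cdot> r = q' \<cdot> s"
    using po' unfolding is_pushout_def by auto
  have "\<exists>!h. h \<in> Hom C (Cod C p) (Cod C p') \<and> h \<cdot> p = p' \<and> h \<cdot> q = q'"
    using po p' unfolding is_pushout_def
    by (elim conjE) (drule (1) bspec, drule (1) bspec, drule (1) bspec, drule (1) mp, assumption)
  then obtain h where h: "h \<in> Arr C" "Dom C h = Cod C p" "h \<cdot> p = p'" "h \<cdot> q = q'"
    by auto
  have "p' \<cdot> (r \<cdot> u) = h \<cdot> (p \<cdot> (r \<cdot> u))"
    using comp_extend[OF h(3), of "r \<cdot> u"] h(1,2) pA rA uvA r by simp
  also have "\<dots> = q' \<cdot> (s \<cdot> v)"
    using comp_extend[OF h(4), of "s \<cdot> v"] h(1,2) pA sA uvA s eq by simp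
  finally show ?thesis
    using rc uv by blast
qed

end

section \<open>Triples of regular epimorphisms\<close>

text \<open>The right-hand side of the theorem, verbatim; the name serves to state the two
  implications separately.\<close>

definition pushout_triples_regular :: "('o, 'a) cat_data \<Rightarrow> bool" where
  "pushout_triples_regular C \<longleftrightarrow>
    (\<forall>X\<in>Obj C. \<forall>r :: nat \<Rightarrow> 'a.
      (\<forall>i\<in>{1..3}. regular_epi C (r i) \<and> Dom C (r i) = X) \<longrightarrow>
        (\<forall>i\<in>{1..3}. \<forall>j\<in>{1..3}. i < j \<longrightarrow> (\<exists>p q. is_pushout C (r i) (r j) p q)) \<and>
        (\<forall>p q L \<pi> a.
          (\<forall>i\<in>{1..3}. \<forall>j\<in>{1..3}. i < j \<longrightarrow> is_pushout C (r i) (r j) (p i j) (q i j)) \<and>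
          is_limit C (pushouts_diagram C r p q) L \<pi> \<and>
          a \<in> Hom C X L \<and> (\<forall>i\<in>{1..3}. \<pi> (VB i) \<cdot>\<^bsub>C\<^esub> a = r i) \<longrightarrow>
          regular_epi C a))"

lemma ball_one_to_three: "(\<forall>i\<in>{1..3::nat}. P i) \<longleftrightarrow> P 1 \<and> P 2 \<and> P 3"
proof -
  have "{1..3::nat} = {1, 2, 3}"
    by auto
  then show ?thesis
    by simp
qed

context regular_cat
begin

lemma pushoutD:
  assumes "is_pushout C r s p q"
  shows "r \<in> Arr C" "s \<in> Arr C" "Dom C r = Dom C s" "p \<in> Arr C" "q \<in> Arr C"
    "Dom C p = Cod C r" "Dom C q = Cod C s" "Cod C q = Cod C p" "p \<cdot> r = q \<cdot> s"
  using assms unfolding is_pushout_def by auto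

lemma pushouts_diagram_simps:
  "Vert (pushouts_diagram C r p q) =
     {VB i | i. i \<in> {1..3}} \<union> {VD i j | i j. i \<in> {1..3} \<and> j \<in> {1..3} \<and> i < j}"
  "Edge (pushouts_diagram C r p q) =
     {EL i j | i j. i \<in> {1..3} \<and> j \<in> {1..3} \<and> i < j} \<union>
     {ER i j | i j. i \<in> {1..3} \<and> j \<in> {1..3} \<and> i < j}"
  "src (pushouts_diagram C r p q) (EL i j) = VB i" "src (pushouts_diagram C r p q) (ER i j) = VB j"
  "tgt (pushouts_diagram C r p q) (EL i j) = VD i j" "tgt (pushouts_diagram C r p q) (ER i j) = VD i j"
  "Dob (pushouts_diagram C r p q) (VB i) = Cod C (r i)"
  "Dob (pushouts_diagram C r p q) (VD i j) = Cod C (p i j)"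
  "Dar (pushouts_diagram C r p q) (EL i j) = p i j" "Dar (pushouts_diagram C r p q) (ER i j) = q i j"
  unfolding pushouts_diagram_def by simp_all

lemma pushouts_diagram_limit_exists:
  assumes po: "\<forall>i\<in>{1..3}. \<forall>j\<in>{1..3}. i < j \<longrightarrow> is_pushout C (r i) (r j) (p i j) (q i j)"
    and r: "\<forall>i\<in>{1..3}. r i \<in> Arr C"
  obtains L \<pi> where "is_limit C (pushouts_diagram C r p q) L \<pi>"
proof (rule finite_limit_exists)
  let ?D = "pushouts_diagram C r p q"
  have pq: "p i j \<in> Hom C (Cod C (r i)) (Cod C (p i j))" "q i j \<in> Hom C (Cod C (r j)) (Cod C (p i j))"
    if "i \<in> {1..3}" "j \<in> {1..3}" "i < j" for i j
    using pushoutD po that by (metis (mono_tags, lifting) Hom_def mem_Collect_eq)+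
  show "is_diagram C ?D"
    unfolding is_diagram_def
  proof (intro conjI ballI)
    fix v
    assume "v \<in> Vert ?D"
    then show "Dob ?D v \<in> Obj C"
      using r pq unfolding pushouts_diagram_simps by (auto simp: pushouts_diagram_simps)
  next
    fix e
    assume "e \<in> Edge ?D"
    then show "src ?D e \<in> Vert ?D" "tgt ?D e \<in> Vert ?D"
        "Dar ?D e \<in> Hom C (Dob ?D (src ?D e)) (Dob ?D (tgt ?D e))"
      using pq by (auto simp: pushouts_diagram_simps)
  qed
  have "Vert ?D \<subseteq> VB ` {1..3} \<union> (\<lambda>(i, j). VD i j) ` ({1..3} \<times> {1..3})"
    unfolding pushouts_diagram_simps by auto
  then show "finite (Vert ?D)"
    by (rule finite_subset) simp
  have "Edge ?D \<subseteq> (\<lambda>(i, j). EL i j) ` ({1..3} \<times> {1..3}) \<union> (\<lambda>(i, j). ER i j) ` ({1..3} \<times> {1..3})"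
    unfolding pushouts_diagram_simps by auto
  then show "finite (Edge ?D)"
    by (rule finite_subset) simp
qed (rule that)

text \<open>The edges \<open>EL i j\<close> force the component at \<open>VD i j\<close>; the edges
  \<open>ER i j\<close> then express exactly the compatibility of the triple.\<close>

lemma pushouts_diagram_cone:
  assumes po: "\<forall>i\<in>{1..3}. \<forall>j\<in>{1..3}. i < j \<longrightarrow> is_pushout C (r i) (r j) (p i j) (q i j)"
    and T: "T \<in> Obj C" and b: "\<forall>i\<in>{1..3}. b i \<in> Hom C T (Cod C (r i))"
    and eq: "\<forall>i\<in>{1..3}. \<forall>j\<in>{1..3}. i < j \<longrightarrow> p i j \<cdot> b i = q i j \<cdot> b j"
  shows "is_cone C (pushouts_diagram C r p q) T (case_pp_vertex b (\<lambda>i j. p i j \<cdot> b i))"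
  unfolding is_cone_def
proof (intro conjI ballI T)
  let ?D = "pushouts_diagram C r p q" and ?\<mu> = "case_pp_vertex b (\<lambda>i j. p i j \<cdot> b i)"
  fix v
  assume "v \<in> Vert ?D"
  then consider i where "i \<in> {1..3}" "v = VB i"
    | i j where "i \<in> {1..3}" "j \<in> {1..3}" "i < j" "v = VD i j"
    unfolding pushouts_diagram_simps by blast
  then show "?\<mu> v \<in> Hom C T (Dob ?D v)"
  proof cases
    case 1
    then show ?thesis
      using b by (simp add: pushouts_diagram_simps)
  next
    case 2
    have "is_pushout C (r i) (r j) (p i j) (q i j)"
      using po 2 by blast
    note D = pushoutD[OF this]
    have "b i \<in> Hom C T (Cod C (r i))"
      using b 2 by blast
    then show ?thesis
      using D 2 by (simp add: pushouts_diagram_simps)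
  qed
next
  let ?D = "pushouts_diagram C r p q" and ?\<mu> = "case_pp_vertex b (\<lambda>i j. p i j \<cdot> b i)"
  fix e
  assume "e \<in> Edge ?D"
  then consider i j where "i \<in> {1..3}" "j \<in> {1..3}" "i < j" "e = EL i j"
    | i j where "i \<in> {1..3}" "j \<in> {1..3}" "i < j" "e = ER i j"
    unfolding pushouts_diagram_simps by blast
  then show "Dar ?D e \<cdot> ?\<mu> (src ?D e) = ?\<mu> (tgt ?D e)"
    using eq by cases (simp_all add: pushouts_diagram_simps)
qed

lemma is_limitD:
  assumes "is_limit C D L \<pi>"
  shows "is_cone C D L \<pi>"
    "is_cone C D T \<mu> \<Longrightarrow> \<exists>!h. h \<in> Hom C T L \<and> (\<forall>v\<in>Vert D. \<pi> v \<cdot> h = \<mu> v)"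
  using assms unfolding is_limit_def by blast+

text \<open>As the components at \<open>VD i j\<close> are determined by those at
  \<open>VB i\<close>, the limit has the universal property of an object of compatible
  triples.\<close>

lemma pushouts_diagram_factor:
  assumes po: "\<forall>i\<in>{1..3}. \<forall>j\<in>{1..3}. i < j \<longrightarrow> is_pushout C (r i) (r j) (p i j) (q i j)"
    and L: "is_limit C (pushouts_diagram C r p q) L \<pi>"
    and T: "T \<in> Obj C" and b: "\<forall>i\<in>{1..3}. b i \<in> Hom C T (Cod C (r i))"
    and eq: "\<forall>i\<in>{1..3}. \<forall>j\<in>{1..3}. i < j \<longrightarrow> p i j \<cdot> b i = q i j \<cdot> b j"
  shows "\<exists>!h. h \<in> Hom C T L \<and> (\<forall>i\<in>{1..3}. \<pi> (VB i) \<cdot> h = b i)"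
proof -
  let ?D = "pushouts_diagram C r p q" and ?\<mu> = "case_pp_vertex b (\<lambda>i j. p i j \<cdot> b i)"
  have cone: "\<And>v. v \<in> Vert ?D \<Longrightarrow> \<pi> v \<in> Hom C L (Dob ?D v)"
      "\<And>e. e \<in> Edge ?D \<Longrightarrow> Dar ?D e \<cdot> \<pi> (src ?D e) = \<pi> (tgt ?D e)"
    using is_limitD(1)[OF L] unfolding is_cone_def by blast+
  have "(\<forall>v\<in>Vert ?D. \<pi> v \<cdot> h = ?\<mu> v) \<longleftrightarrow> (\<forall>i\<in>{1..3}. \<pi> (VB i) \<cdot> h = b i)"
    if h: "h \<in> Hom C T L" for h
  proof
    assume "\<forall>v\<in>Vert ?D. \<pi> v \<cdot> h = ?\<mu> v"
    moreover have "VB i \<in> Vert ?D" if "i \<in> {1..3}" for i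
      using that unfolding pushouts_diagram_simps by blast
    ultimately have "\<pi> (VB i) \<cdot> h = ?\<mu> (VB i)" if "i \<in> {1..3}" for i
      using that by blast
    then show "\<forall>i\<in>{1..3}. \<pi> (VB i) \<cdot> h = b i"
      by simp
  next
    assume B: "\<forall>i\<in>{1..3}. \<pi> (VB i) \<cdot> h = b i"
    show "\<forall>v\<in>Vert ?D. \<pi> v \<cdot> h = ?\<mu> v"
    proof
      fix v
      assume v: "v \<in> Vert ?D"
      then consider i where "i \<in> {1..3}" "v = VB i"
        | i j where "i \<in> {1..3}" "j \<in> {1..3}" "i < j" "v = VD i j"
        unfolding pushouts_diagram_simps by blast
      then show "\<pi> v \<cdot> h = ?\<mu> v"
      proof cases
        case 1
        then show ?thesis
          using B by simp
      next
        case 2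
        have "is_pushout C (r i) (r j) (p i j) (q i j)"
          using po 2 by blast
        note pA = pushoutD(4,6)[OF this]
        have "VB i \<in> Vert ?D" "EL i j \<in> Edge ?D"
          using 2 unfolding pushouts_diagram_simps by blast+
        note c = cone(1)[OF this(1)] cone(2)[OF this(2)]
        have "p i j \<cdot> \<pi> (VB i) = \<pi> (VD i j)" "\<pi> (VB i) \<in> Arr C" "Dom C (\<pi> (VB i)) = L"
            "Cod C (\<pi> (VB i)) = Cod C (r i)"
          using c by (simp_all add: pushouts_diagram_simps)
        then have "\<pi> (VD i j) \<cdot> h = p i j \<cdot> (\<pi> (VB i) \<cdot> h)"
          using comp_extend[of "p i j" "\<pi> (VB i)" "\<pi> (VD i j)" h] pA h by simp
        then show ?thesis
          using B 2 by simp
      qed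
    qed
  qed
  then have iff: "h \<in> Hom C T L \<and> (\<forall>v\<in>Vert ?D. \<pi> v \<cdot> h = ?\<mu> v) \<longleftrightarrow>
      h \<in> Hom C T L \<and> (\<forall>i\<in>{1..3}. \<pi> (VB i) \<cdot> h = b i)" for h
    by blast
  show ?thesis
    using is_limitD(2)[OF L pushouts_diagram_cone[OF po T b eq]] unfolding iff .
qed

text \<open>Generalized elements of the limit are compatible triples, and a morphism into the limit
  is a regular epimorphism as soon as the generic element lifts along a cover.\<close>

lemma triple_lift:
  fixes r :: "nat \<Rightarrow> 'a"
  assumes cond: "pushout_triples_regular C" and X: "X \<in> Obj C"
    and r: "\<forall>i\<in>{1..3}. regular_epi C (r i) \<and> Dom C (r i) = X"
    and po: "\<forall>i\<in>{1..3}. \<forall>j\<in>{1..3}. i < j \<longrightarrow> is_pushout C (r i) (r j) (p i j) (q i j)"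
    and T: "T \<in> Obj C" and b: "\<forall>i\<in>{1..3}. b i \<in> Hom C T (Cod C (r i))"
    and eq: "\<forall>i\<in>{1..3}. \<forall>j\<in>{1..3}. i < j \<longrightarrow> p i j \<cdot> b i = q i j \<cdot> b j"
  obtains T' c z where "cover c T' T" "z \<in> Arr C" "Dom C z = T'" "Cod C z = X"
    "\<forall>i\<in>{1..3}. r i \<cdot> z = b i \<cdot> c"
proof -
  have rA: "\<forall>i\<in>{1..3}. r i \<in> Arr C" "\<forall>i\<in>{1..3}. r i \<in> Hom C X (Cod C (r i))"
    using r by auto
  obtain L \<pi> where L: "is_limit C (pushouts_diagram C r p q) L \<pi>"
    using pushouts_diagram_limit_exists[OF po rA(1)] by blast
  have "\<forall>i\<in>{1..3}. \<forall>j\<in>{1..3}. i < j \<longrightarrow> p i j \<cdot> r i = q i j \<cdot> r j"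
    using po pushoutD(9) by blast
  from ex1_implies_ex[OF pushouts_diagram_factor[OF po L X rA(2) this]]
  obtain a where a: "a \<in> Hom C X L" "\<forall>i\<in>{1..3}. \<pi> (VB i) \<cdot> a = r i"
    by blast
  have reg: "regular_epi C a"
    using cond X r po L a unfolding pushout_triples_regular_def by blast
  from ex1_implies_ex[OF pushouts_diagram_factor[OF po L T b eq]]
  obtain h where h: "h \<in> Hom C T L" "\<forall>i\<in>{1..3}. \<pi> (VB i) \<cdot> h = b i"
    by blast
  obtain T' c z where c: "cover c T' T" and z: "z \<in> Arr C" "Dom C z = T'" "Cod C z = X" "a \<cdot> z = h \<cdot> c"
    by (rule regular_epi_lift[OF reg, of h T]) (use a h in auto)
  note cA = coverD[OF c]
  have "r i \<cdot> z = b i \<cdot> c" if i: "i \<in> {1..3}" for i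
  proof -
    have "VB i \<in> Vert (pushouts_diagram C r p q)"
      using i unfolding pushouts_diagram_simps by blast
    then have \<pi>: "\<pi> (VB i) \<in> Arr C" "Dom C (\<pi> (VB i)) = L"
      using is_limitD(1)[OF L] unfolding is_cone_def by auto
    have "\<pi> (VB i) \<cdot> a = r i" "\<pi> (VB i) \<cdot> h = b i"
      using a(2) h(2) i by blast+
    from comp_extend[OF this(1), of z] comp_extend[OF this(2), of c] show ?thesis
      using \<pi> z a(1) h(1) cA by simp
  qed
  with that c z show ?thesis
    by blast
qed

lemma regular_epi_into_limit:
  fixes r :: "nat \<Rightarrow> 'a"
  assumes po: "\<forall>i\<in>{1..3}. \<forall>j\<in>{1..3}. i < j \<longrightarrow> is_pushout C (r i) (r j) (p i j) (q i j)"
    and L: "is_limit C (pushouts_diagram C r p q) L \<pi>"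
    and a: "a \<in> Hom C X L" "\<forall>i\<in>{1..3}. \<pi> (VB i) \<cdot> a = r i"
    and lift: "\<And>T b. T \<in> Obj C \<Longrightarrow> \<forall>i\<in>{1..3}. b i \<in> Hom C T (Cod C (r i)) \<Longrightarrow>
      \<forall>i\<in>{1..3}. \<forall>j\<in>{1..3}. i < j \<longrightarrow> p i j \<cdot> b i = q i j \<cdot> b j \<Longrightarrow>
      \<exists>T' c z. cover c T' T \<and> z \<in> Hom C T' X \<and> (\<forall>i\<in>{1..3}. r i \<cdot> z = b i \<cdot> c)"
  shows "regular_epi C a"
proof -
  let ?D = "pushouts_diagram C r p q" and ?b = "\<lambda>i. \<pi> (VB i)"
  have LO: "L \<in> Obj C"
    using is_limitD(1)[OF L] unfolding is_cone_def by blast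
  have cone: "\<And>v. v \<in> Vert ?D \<Longrightarrow> \<pi> v \<in> Hom C L (Dob ?D v)"
      "\<And>e. e \<in> Edge ?D \<Longrightarrow> Dar ?D e \<cdot> \<pi> (src ?D e) = \<pi> (tgt ?D e)"
    using is_limitD(1)[OF L] unfolding is_cone_def by blast+
  have b: "\<forall>i\<in>{1..3}. ?b i \<in> Hom C L (Cod C (r i))"
  proof
    fix i :: nat
    assume "i \<in> {1..3}"
    then have "VB i \<in> Vert ?D"
      unfolding pushouts_diagram_simps by blast
    from cone(1)[OF this] show "?b i \<in> Hom C L (Cod C (r i))"
      unfolding pushouts_diagram_simps .
  qed
  have eq: "\<forall>i\<in>{1..3}. \<forall>j\<in>{1..3}. i < j \<longrightarrow> p i j \<cdot> ?b i = q i j \<cdot> ?b j"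
  proof (intro ballI impI)
    fix i j :: nat
    assume "i \<in> {1..3}" "j \<in> {1..3}" "i < j"
    then have "EL i j \<in> Edge ?D" "ER i j \<in> Edge ?D"
      unfolding pushouts_diagram_simps by blast+
    from cone(2)[OF this(1)] cone(2)[OF this(2)] show "p i j \<cdot> ?b i = q i j \<cdot> ?b j"
      unfolding pushouts_diagram_simps by simp
  qed
  \<comment> \<open>The lifting hypothesis is applied to the projections of the limit, that is, to
    the generic compatible triple at stage \<open>L\<close>.\<close>
  obtain T' c z where c: "cover c T' L" and z: "z \<in> Hom C T' X"
    and rz: "\<forall>i\<in>{1..3}. r i \<cdot> z = ?b i \<cdot> c"
    using lift[OF LO b eq] by blast
  note cA = coverD[OF c]
  have T': "T' \<in> Obj C"
    using cA by auto
  have b': "\<forall>i\<in>{1..3}. ?b i \<cdot> c \<in> Hom C T' (Cod C (r i))"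
    using b cA by auto
  have eq': "\<forall>i\<in>{1..3}. \<forall>j\<in>{1..3}. i < j \<longrightarrow> p i j \<cdot> (?b i \<cdot> c) = q i j \<cdot> (?b j \<cdot> c)"
  proof (intro ballI impI)
    fix i j :: nat
    assume ij: "i \<in> {1..3}" "j \<in> {1..3}" "i < j"
    have "is_pushout C (r i) (r j) (p i j) (q i j)" "p i j \<cdot> ?b i = q i j \<cdot> ?b j"
        "?b i \<in> Hom C L (Cod C (r i))" "?b j \<in> Hom C L (Cod C (r j))"
      using po eq b ij by blast+
    then show "p i j \<cdot> (?b i \<cdot> c) = q i j \<cdot> (?b j \<cdot> c)"
      using comp_extend[of "p i j" "?b i" "q i j \<cdot> ?b j" c] pushoutD(4-8)[of "r i" "r j" "p i j" "q i j"] cA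
      by simp
  qed
  have "?b i \<cdot> (a \<cdot> z) = ?b i \<cdot> c" if i: "i \<in> {1..3}" for i
  proof -
    have "?b i \<cdot> a = r i" "?b i \<in> Hom C L (Cod C (r i))" "r i \<cdot> z = ?b i \<cdot> c"
      using a(2) b rz i by blast+
    then show ?thesis
      using comp_extend[of "?b i" a "r i" z] a(1) z by simp
  qed
  moreover have "a \<cdot> z \<in> Hom C T' L" "c \<in> Hom C T' L"
    using a z cA by auto
  \<comment> \<open>Both arrows into the limit have the same three components. So \<open>a\<close>
    is the last factor of a cover.\<close>
  ultimately have "a \<cdot> z = c"
    using pushouts_diagram_factor[OF po L T' b' eq'] by blast
  then have "regular_epi C (a \<cdot> z)"
    using cA by simp
  then show ?thesis
    by (rule regular_epi_right_factor) (use a z in auto)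
qed

end

section \<open>Exactness, the Mal'tsev property and distributivity\<close>

context regular_cat
begin

text \<open>The limit for the legs \<open>(l, k, k)\<close> consists in effect of the pairs in
  \<open>X\<close> identified by the coprojection \<open>p\<close>. Local surjectivity of the
  comparison from \<open>Dom C m\<close> says that every such pair lies locally in \<open>m\<close>,
  and then it lies in \<open>m\<close>.\<close>

lemma pushout_triples_kernel_pair:
  assumes cond: "pushout_triples_regular C"
    and m: "internal_relation C X m" and refl: "internal_reflexive C X m"
  obtains f where "is_kernel_pair C f (leg0 C X m) (leg1 C X m)"
proof -
  let ?l = "leg0 C X m" and ?k = "leg1 C X m"
  obtain s where s: "s \<in> Arr C" "Dom C s = X" "Cod C s = Dom C m" "?l \<cdot> s = Ident C X" "?k \<cdot> s = Ident C X"
    using refl unfolding internal_reflexive_def by auto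
  have reg: "regular_epi C ?l" "regular_epi C ?k"
    using split_epi_regular[of ?l s] split_epi_regular[of ?k s] s m by auto
  define r where "r i = (if i = 1 then ?l else ?k)" for i :: nat
  have Y: "Dom C m \<in> Obj C"
    using m by simp
  have r: "\<forall>i\<in>{1..3}. regular_epi C (r i) \<and> Dom C (r i) = Dom C m"
    using reg m unfolding r_def by simp
  then have ex: "\<forall>i\<in>{1..3}. \<forall>j\<in>{1..3}. i < j \<longrightarrow> (\<exists>p q. is_pushout C (r i) (r j) p q)"
    using cond Y unfolding pushout_triples_regular_def by blast
  obtain p q where pq: "is_pushout C ?l ?k p q"
    using ex[unfolded ball_one_to_three] unfolding r_def by auto
  obtain p' q' where pq': "is_pushout C ?k ?k p' q'"
    using ex[unfolded ball_one_to_three] unfolding r_def by auto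
  note pA = pushoutD[OF pq] and pA' = pushoutD[OF pq']
  \<comment> \<open>Precompose the pushout square with the common section \<open>s\<close> of the
    two legs.\<close>
  have "p = q"
    using comp_extend[OF pA(9), of s] pA s m by simp
  have "p' = q'"
    by (rule regular_epi_cancel[OF reg(2)]) (use pA' m in auto)
  \<comment> \<open>The second leg stands at positions 2 and 3, so the pairs (1,2) and (1,3) share
    one pushout, and (2,3) is the pushout of the second leg with itself.\<close>
  define P where "P i j = (if i = 1 then p else p')" for i j :: nat
  define Q where "Q i j = (if i = 1 then q else q')" for i j :: nat
  have po: "\<forall>i\<in>{1..3}. \<forall>j\<in>{1..3}. i < j \<longrightarrow> is_pushout C (r i) (r j) (P i j) (Q i j)"
    unfolding ball_one_to_three r_def P_def Q_def using pq pq' by simp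
  have rel: "related X m u v \<longleftrightarrow> parallel X u v \<and> p \<cdot> u = p \<cdot> v" for u v
  proof
    assume uv: "related X m u v"
    have "p \<cdot> ?l = p \<cdot> ?k"
      using pA(9) \<open>p = q\<close> by simp
    then have "p \<cdot> u = p \<cdot> v"
      by (intro coequalizes_related[OF m _ _ _ uv]) (use pA m in auto)
    then show "parallel X u v \<and> p \<cdot> u = p \<cdot> v"
      using relatedD(1)[OF m uv] by blast
  next
    assume uv: "parallel X u v \<and> p \<cdot> u = p \<cdot> v"
    then have uvA: "u \<in> Arr C" "v \<in> Arr C" "Dom C v = Dom C u" "Cod C u = X" "Cod C v = X"
      unfolding parallel_def by auto
    \<comment> \<open>The triple \<open>(u, v, v)\<close>: compatibility at (1,2) and (1,3) is the
      assumption on \<open>p\<close>, and at (2,3) it is \<open>p' = q'\<close>.\<close>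
    define b where "b i = (if i = 1 then u else v)" for i :: nat
    have b: "\<forall>i\<in>{1..3}. b i \<in> Hom C (Dom C u) (Cod C (r i))"
      using uvA m unfolding b_def r_def by simp
    have eq: "\<forall>i\<in>{1..3}. \<forall>j\<in>{1..3}. i < j \<longrightarrow> P i j \<cdot> b i = Q i j \<cdot> b j"
      unfolding ball_one_to_three b_def P_def Q_def using uv \<open>p = q\<close> \<open>p' = q'\<close> by simp
    have T: "Dom C u \<in> Obj C"
      using uvA by simp
    obtain T c z where c: "cover c T (Dom C u)" and z: "z \<in> Arr C" "Dom C z = T" "Cod C z = Dom C m"
      and rz: "\<forall>i\<in>{1..3}. r i \<cdot> z = b i \<cdot> c"
      by (rule triple_lift[OF cond Y r po T b eq]) (rule that)
    have "related X m (u \<cdot> c) (v \<cdot> c)"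
      using rz[unfolded ball_one_to_three] z unfolding related_def r_def b_def
      by (intro bexI[of _ z]) auto
    then show "related X m u v"
      using related_local[OF m _ c] uv by blast
  qed
  show ?thesis
    by (rule that[of p]) (use kernel_pair_legs_iff[OF m, of p] rel pA m in auto)
qed

text \<open>A reflexive relation that is a kernel pair is both effective and an equivalence
  relation, so one fact yields the two properties.\<close>

lemma pushout_triples_exact_maltsev:
  assumes cond: "pushout_triples_regular C"
  shows "exact_category C" "maltsev_category C"
proof -
  have "effective C X m" if "internal_relation C X m" "internal_reflexive C X m" for X m
    using pushout_triples_kernel_pair[OF cond that] unfolding effective_def by blast
  then show "exact_category C"
    using regular unfolding exact_category_def internal_equivalence_def by blast
  have "internal_equivalence C X m"
    if m: "internal_relation C X m" and refl: "internal_reflexive C X m" for X m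
  proof -
    obtain f where "is_kernel_pair C f (leg0 C X m) (leg1 C X m)"
      using pushout_triples_kernel_pair[OF cond m refl] by blast
    then have f: "f \<in> Arr C" "Dom C f = X" "\<And>u v. related X m u v \<longleftrightarrow> parallel X u v \<and> f \<cdot> u = f \<cdot> v"
      unfolding kernel_pair_legs_iff[OF m] by blast+
    show ?thesis
      by (rule kernel_relation_equivalence[OF m f])
  qed
  then show "maltsev_category C"
    using finitely_complete unfolding maltsev_category_def by blast
qed

end

section \<open>Distributivity and the lifting of compatible triples\<close>

context regular_maltsev_cat
begin

text \<open>Exactness turns the three relations into kernel pairs of quotients. The triple of
  classes of \<open>u\<close>, \<open>u\<close>, \<open>v\<close> is compatible for three different
  reasons: the first two components come from the same element, \<open>x\<close> relates
  \<open>u\<close> to \<open>v\<close>, and \<open>u\<close> and \<open>v\<close> are joined by the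
  composite of \<open>y\<close> and \<open>z\<close>.\<close>

lemma pushout_triples_distributive:
  assumes cond: "pushout_triples_regular C" and X: "X \<in> Obj C"
  shows "distributive_lattice (Equiv C X)"
  unfolding distributive_lattice_iff
proof (intro allI impI)
  fix x y z u v
  assume x: "internal_equivalence C X x" and y: "internal_equivalence C X y"
    and z: "internal_equivalence C X z" and xuv: "related X x u v" and yzuv: "related_comp X y z u v"
  note exact = pushout_triples_exact_maltsev(1)[OF cond]
  obtain r1 where r1: "regular_epi C r1" "Dom C r1 = X"
    and rel1: "\<And>u v. related X x u v \<longleftrightarrow> parallel X u v \<and> r1 \<cdot> u = r1 \<cdot> v"
    by (rule exact_quotient_exists[OF exact x]) (rule that)
  obtain r2 where r2: "regular_epi C r2" "Dom C r2 = X"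
    and rel2: "\<And>u v. related X y u v \<longleftrightarrow> parallel X u v \<and> r2 \<cdot> u = r2 \<cdot> v"
    by (rule exact_quotient_exists[OF exact y]) (rule that)
  obtain r3 where r3: "regular_epi C r3" "Dom C r3 = X"
    and rel3: "\<And>u v. related X z u v \<longleftrightarrow> parallel X u v \<and> r3 \<cdot> u = r3 \<cdot> v"
    by (rule exact_quotient_exists[OF exact z]) (rule that)
  have rA: "r1 \<in> Arr C" "r2 \<in> Arr C" "r3 \<in> Arr C"
    using r1 r2 r3 by auto
  define r where "r i = (if i = 1 then r1 else if i = 2 then r2 else r3)" for i :: nat
  have r: "\<forall>i\<in>{1..3}. regular_epi C (r i) \<and> Dom C (r i) = X"
    using r1 r2 r3 unfolding r_def by simp
  then have "\<forall>i\<in>{1..3}. \<forall>j\<in>{1..3}. i < j \<longrightarrow> (\<exists>p q. is_pushout C (r i) (r j) p q)"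
    using cond X unfolding pushout_triples_regular_def by blast
  then obtain p q where
    po: "\<forall>i\<in>{1..3}. \<forall>j\<in>{1..3}. i < j \<longrightarrow> is_pushout C (r i) (r j) (p i j) (q i j)"
    by metis
  have po12: "is_pushout C r1 r2 (p 1 2) (q 1 2)" and po13: "is_pushout C r1 r3 (p 1 3) (q 1 3)"
    and po23: "is_pushout C r2 r3 (p 2 3) (q 2 3)"
    using po[unfolded ball_one_to_three] unfolding r_def by simp_all
  note p12 = pushoutD[OF po12] and p13 = pushoutD[OF po13] and p23 = pushoutD[OF po23]
  have uvA: "u \<in> Arr C" "v \<in> Arr C" "Dom C v = Dom C u" "Cod C u = X" "Cod C v = X" "r1 \<cdot> u = r1 \<cdot> v"
    using xuv unfolding rel1 parallel_def by auto
  define b where "b i = (if i = 1 then r1 \<cdot> u else if i = 2 then r2 \<cdot> u else r3 \<cdot> v)" for i :: nat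
  have b: "\<forall>i\<in>{1..3}. b i \<in> Hom C (Dom C u) (Cod C (r i))"
    using uvA rA r1 r2 r3 unfolding b_def r_def by simp
  have eq12: "p 1 2 \<cdot> (r1 \<cdot> u) = q 1 2 \<cdot> (r2 \<cdot> u)"
    using comp_extend[OF p12(9), of u] uvA p12 r2 by simp
  have eq13: "p 1 3 \<cdot> (r1 \<cdot> u) = q 1 3 \<cdot> (r3 \<cdot> v)"
    using comp_extend[OF p13(9), of v] uvA p13 r3 by simp
  obtain T d w where d: "cover d T (Dom C u)" and w: "related X y (u \<cdot> d) w" "related X z w (v \<cdot> d)"
    using yzuv by (rule related_compE)
  note dA = coverD[OF d]
  have wA: "w \<in> Arr C" "Cod C w = X" "r2 \<cdot> (u \<cdot> d) = r2 \<cdot> w" "r3 \<cdot> w = r3 \<cdot> (v \<cdot> d)"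
    using w unfolding rel2 rel3 parallel_def by auto
  \<comment> \<open>The equation is checked over the cover \<open>d\<close>, where the middle
    element \<open>w\<close> has the \<open>y\<close>-class of \<open>u\<close> and the
    \<open>z\<close>-class of \<open>v\<close>.\<close>
  have "(p 2 3 \<cdot> (r2 \<cdot> u)) \<cdot> d = p 2 3 \<cdot> (r2 \<cdot> w)"
    using uvA dA p23 r2 r3 wA(3) by simp
  also have "\<dots> = q 2 3 \<cdot> (r3 \<cdot> w)"
    using comp_extend[OF p23(9), of w] wA p23 r3 by simp
  also have "\<dots> = (q 2 3 \<cdot> (r3 \<cdot> v)) \<cdot> d"
    using uvA dA p23 r2 r3 wA(4) by simp
  finally have eq23: "p 2 3 \<cdot> (r2 \<cdot> u) = q 2 3 \<cdot> (r3 \<cdot> v)"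
    by (rule regular_epi_cancel[OF dA(1), rotated -1]) (use uvA p23 r2 r3 dA in auto)
  have eq: "\<forall>i\<in>{1..3}. \<forall>j\<in>{1..3}. i < j \<longrightarrow> p i j \<cdot> b i = q i j \<cdot> b j"
    unfolding ball_one_to_three b_def using eq12 eq13 eq23 by simp
  have T: "Dom C u \<in> Obj C"
    using uvA by simp
  obtain T' c t where c: "cover c T' (Dom C u)" and t: "t \<in> Arr C" "Dom C t = T'" "Cod C t = X"
    and rt: "\<forall>i\<in>{1..3}. r i \<cdot> t = b i \<cdot> c"
    by (rule triple_lift[OF cond X r po T b eq]) (rule that)
  note cA = coverD[OF c]
  have "r1 \<cdot> t = r1 \<cdot> (u \<cdot> c)" "r2 \<cdot> t = r2 \<cdot> (u \<cdot> c)" "r3 \<cdot> t = r3 \<cdot> (v \<cdot> c)"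
    using rt[unfolded ball_one_to_three] uvA(1-5) cA rA r1 r2 r3 unfolding r_def b_def by simp_all
  then have "related X x (u \<cdot> c) t" "related X y (u \<cdot> c) t" "related X z t (v \<cdot> c)"
    using t uvA(1-5) cA unfolding rel1 rel2 rel3 parallel_def by simp_all
  with c show "\<exists>T c w. cover c T (Dom C u) \<and> related X x (u \<cdot> c) w \<and> related X y (u \<cdot> c) w \<and>
      related X z w (v \<cdot> c)"
    by blast
qed

text \<open>The case of two components: the comparison from \<open>X\<close> to the pullback of the
  coprojections is a regular epimorphism. Lifts \<open>x\<close> and \<open>x'\<close> of the two
  components are chosen independently; compatibility puts them into the composite of the kernel
  pairs, and the middle element lies over both components.\<close>

lemma exact_pushout_lift:
  assumes exact: "exact_category C"
    and r: "regular_epi C r" "Dom C r = X" and s: "regular_epi C s" "Dom C s = X"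
    and po: "is_pushout C r s p q"
    and b: "b \<in> Hom C T (Cod C r)" and d: "d \<in> Hom C T (Cod C s)" and eq: "p \<cdot> b = q \<cdot> d"
  obtains T' c y where "cover c T' T" "y \<in> Hom C T' X" "r \<cdot> y = b \<cdot> c" "s \<cdot> y = d \<cdot> c"
proof -
  note pA = pushoutD[OF po]
  obtain m where m: "internal_relation C X m" and mrel: "\<And>u v. related X m u v \<longleftrightarrow> parallel X u v \<and> r \<cdot> u = r \<cdot> v"
    by (rule kernel_relation_exists[OF pA(1) r(2)]) (rule that)
  obtain n where n: "internal_relation C X n" and nrel: "\<And>u v. related X n u v \<longleftrightarrow> parallel X u v \<and> s \<cdot> u = s \<cdot> v"
    by (rule kernel_relation_exists[OF pA(2) s(2)]) (rule that)
  obtain T1 c1 x where c1: "cover c1 T1 T" and x: "x \<in> Arr C" "Dom C x = T1" "Cod C x = X" "r \<cdot> x = b \<cdot> c1"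
    by (rule regular_epi_lift[OF r(1), of b T]) (use b r in auto)
  note c1A = coverD[OF c1]
  obtain T2 c2 x' where c2: "cover c2 T2 T1" and x': "x' \<in> Arr C" "Dom C x' = T2" "Cod C x' = X"
      "s \<cdot> x' = (d \<cdot> c1) \<cdot> c2"
    by (rule regular_epi_lift[OF s(1), of "d \<cdot> c1" T1]) (use d s c1A in auto)
  note c2A = coverD[OF c2]
  have "p \<cdot> (r \<cdot> (x \<cdot> c2)) = p \<cdot> (b \<cdot> (c1 \<cdot> c2))"
    using comp_extend[OF x(4), of c2] x c1A c2A b r pA by simp
  also have "\<dots> = q \<cdot> (d \<cdot> (c1 \<cdot> c2))"
    using comp_extend[OF eq, of "c1 \<cdot> c2"] c1A c2A b d pA by simp
  also have "\<dots> = q \<cdot> (s \<cdot> x')"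
    using x'(4) c1A c2A d by simp
  finally have "related_comp X m n (x \<cdot> c2) x'"
    by (intro exact_pushout_related_comp[OF exact r s m mrel n nrel po])
      (use x x' c2A in \<open>auto simp: parallel_def\<close>)
  then obtain T3 c3 y where c3: "cover c3 T3 (Dom C (x \<cdot> c2))" and y: "related X m ((x \<cdot> c2) \<cdot> c3) y"
      "related X n y (x' \<cdot> c3)"
    by (rule related_compE)
  have c3': "cover c3 T3 T2"
    using c3 x c2A by simp
  note c3A = coverD[OF c3']
  have yA: "y \<in> Hom C T3 X" "r \<cdot> y = r \<cdot> ((x \<cdot> c2) \<cdot> c3)" "s \<cdot> y = s \<cdot> (x' \<cdot> c3)"
    using y x x' c2A c3A unfolding mrel nrel parallel_def by auto
  show ?thesis
  proof (rule that)
    show "cover (c1 \<cdot> (c2 \<cdot> c3)) T3 T"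
      using cover_comp[OF c1 cover_comp[OF c2 c3']] .
    show "r \<cdot> y = b \<cdot> (c1 \<cdot> (c2 \<cdot> c3))"
      unfolding yA(2) using comp_extend[OF x(4), of "c2 \<cdot> c3"] x c1A c2A c3A b r pA by simp
    show "s \<cdot> y = d \<cdot> (c1 \<cdot> (c2 \<cdot> c3))"
      unfolding yA(3) using comp_extend[OF x'(4), of c3] x' c1A c2A c3A d s pA by simp
  qed (rule yA)
qed

text \<open>The dual form \<open>(x \<or> z) \<and> (y \<or> z) \<le> (x \<and> y) \<or> z\<close> of the distributive law.\<close>

lemma distributive_related_comp:
  assumes dist: "distributive_lattice (Equiv C X)"
    and x: "internal_equivalence C X x" and y: "internal_equivalence C X y" and z: "internal_equivalence C X z"
    and xz: "related_comp X x z u v" and yz: "related_comp X y z u v"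
  obtains T c w where "cover c T (Dom C u)" "related X x (u \<cdot> c) w" "related X y (u \<cdot> c) w"
    "related X z w (v \<cdot> c)"
proof -
  note xD = internal_equivalenceD[OF x] and zD = internal_equivalenceD[OF z]
  obtain k where k: "internal_equivalence C X k"
    and rel: "\<And>u v. related X k u v \<longleftrightarrow> related_comp X y z u v"
    and zk: "\<And>u v. related X z u v \<Longrightarrow> related X k u v"
    by (rule comp_equivalence_exists[OF y z]) (rule that)
  note kD = internal_equivalenceD[OF k]
  obtain T c t where c: "cover c T (Dom C u)" and t: "related X x (u \<cdot> c) t" "related X z t (v \<cdot> c)"
    using xz by (rule related_compE)
  note cA = coverD[OF c]
  have uA: "u \<in> Arr C" "v \<in> Arr C" "Dom C v = Dom C u"
    using xz unfolding related_comp_def parallel_def by auto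
  note tA = relatedD[OF xD(1) t(1)]
  have tT: "Dom C t = T"
    using tA uA cA by simp
  have "related X k (u \<cdot> c) (v \<cdot> c)"
    using related_precomp[OF kD(1)] yz cA unfolding rel by blast
  \<comment> \<open>Since \<open>z\<close> lies below the join \<open>k\<close> of \<open>y\<close>
    and \<open>z\<close>, the element \<open>t\<close> is still \<open>k\<close>-related to
    \<open>u\<close>. The usual distributive law, applied to \<open>u\<close> and \<open>t\<close>
    instead of \<open>u\<close> and \<open>v\<close>, now suffices.\<close>
  then have "related X k (u \<cdot> c) t"
    using kD(4) zk[OF zD(3)[OF t(2)]] by blast
  then have "related_comp X y z (u \<cdot> c) t"
    unfolding rel .
  then obtain T' e w where e: "cover e T' (Dom C (u \<cdot> c))"
    and w: "related X x ((u \<cdot> c) \<cdot> e) w" "related X y ((u \<cdot> c) \<cdot> e) w" "related X z w (t \<cdot> e)"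
    using dist[unfolded distributive_lattice_iff] x y z t(1) by blast
  have e': "cover e T' T"
    using e uA cA by simp
  note eA = coverD[OF e']
  have "related X z (t \<cdot> e) ((v \<cdot> c) \<cdot> e)"
    by (rule related_precomp[OF zD(1) t(2)]) (use eA tT in simp_all)
  then have "related X z w ((v \<cdot> c) \<cdot> e)"
    using zD(4) w(3) by blast
  then show ?thesis
    using that[OF cover_comp[OF c e'], of w] w uA cA eA by simp
qed

lemma exact_triple_lift:
  fixes r :: "nat \<Rightarrow> 'a"
  assumes exact: "exact_category C" and dist: "distributive_lattice (Equiv C X)"
    and r: "\<forall>i\<in>{1..3}. regular_epi C (r i) \<and> Dom C (r i) = X"
    and po: "\<forall>i\<in>{1..3}. \<forall>j\<in>{1..3}. i < j \<longrightarrow> is_pushout C (r i) (r j) (p i j) (q i j)"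
    and b: "\<forall>i\<in>{1..3}. b i \<in> Hom C T (Cod C (r i))"
    and eq: "\<forall>i\<in>{1..3}. \<forall>j\<in>{1..3}. i < j \<longrightarrow> p i j \<cdot> b i = q i j \<cdot> b j"
  shows "\<exists>T' c z. cover c T' T \<and> z \<in> Hom C T' X \<and> (\<forall>i\<in>{1..3}. r i \<cdot> z = b i \<cdot> c)"
proof -
  have r1: "regular_epi C (r 1)" "Dom C (r 1) = X" and r2: "regular_epi C (r 2)" "Dom C (r 2) = X"
    and r3: "regular_epi C (r 3)" "Dom C (r 3) = X"
    using r unfolding ball_one_to_three by blast+
  have po12: "is_pushout C (r 1) (r 2) (p 1 2) (q 1 2)" and po13: "is_pushout C (r 1) (r 3) (p 1 3) (q 1 3)"
    and po23: "is_pushout C (r 2) (r 3) (p 2 3) (q 2 3)"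
    using po unfolding ball_one_to_three by simp_all
  note p13 = pushoutD[OF po13] and p23 = pushoutD[OF po23]
  have eqs: "p 1 2 \<cdot> b 1 = q 1 2 \<cdot> b 2" "p 1 3 \<cdot> b 1 = q 1 3 \<cdot> b 3" "p 2 3 \<cdot> b 2 = q 2 3 \<cdot> b 3"
    using eq unfolding ball_one_to_three by simp_all
  have bs: "b 1 \<in> Hom C T (Cod C (r 1))" "b 2 \<in> Hom C T (Cod C (r 2))" "b 3 \<in> Hom C T (Cod C (r 3))"
    using b unfolding ball_one_to_three by blast+
  obtain x where x: "internal_relation C X x" and xrel: "\<And>u v. related X x u v \<longleftrightarrow> parallel X u v \<and> r 1 \<cdot> u = r 1 \<cdot> v"
    by (rule kernel_relation_exists[OF regular_epi_Arr[OF r1(1)] r1(2)]) (rule that)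
  obtain y where y: "internal_relation C X y" and yrel: "\<And>u v. related X y u v \<longleftrightarrow> parallel X u v \<and> r 2 \<cdot> u = r 2 \<cdot> v"
    by (rule kernel_relation_exists[OF regular_epi_Arr[OF r2(1)] r2(2)]) (rule that)
  obtain z where z: "internal_relation C X z" and zrel: "\<And>u v. related X z u v \<longleftrightarrow> parallel X u v \<and> r 3 \<cdot> u = r 3 \<cdot> v"
    by (rule kernel_relation_exists[OF regular_epi_Arr[OF r3(1)] r3(2)]) (rule that)
  have xe: "internal_equivalence C X x" and ye: "internal_equivalence C X y" and ze: "internal_equivalence C X z"
    using kernel_relation_equivalence[OF x regular_epi_Arr[OF r1(1)] r1(2) xrel]
      kernel_relation_equivalence[OF y regular_epi_Arr[OF r2(1)] r2(2) yrel]
      kernel_relation_equivalence[OF z regular_epi_Arr[OF r3(1)] r3(2) zrel] .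
  obtain T1 c t where c: "cover c T1 T" and t: "t \<in> Hom C T1 X" "r 1 \<cdot> t = b 1 \<cdot> c" "r 2 \<cdot> t = b 2 \<cdot> c"
    using exact_pushout_lift[OF exact r1 r2 po12 bs(1,2) eqs(1)] by blast
  note cA = coverD[OF c]
  obtain T2 d v where d: "cover d T2 T1" and v: "v \<in> Arr C" "Dom C v = T2" "Cod C v = X" "r 3 \<cdot> v = (b 3 \<cdot> c) \<cdot> d"
    by (rule regular_epi_lift[OF r3(1), of "b 3 \<cdot> c" T1]) (use bs cA r3 in auto)
  note dA = coverD[OF d]
  let ?u = "t \<cdot> d"
  have ru: "r 1 \<cdot> ?u = b 1 \<cdot> (c \<cdot> d)" "r 2 \<cdot> ?u = b 2 \<cdot> (c \<cdot> d)" "r 3 \<cdot> v = b 3 \<cdot> (c \<cdot> d)"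
    using comp_extend[OF t(2), of d] comp_extend[OF t(3), of d] t(1) v cA dA r1 r2 r3 bs by simp_all
  have uv: "parallel X ?u v"
    using t(1) dA v unfolding parallel_def by simp
  \<comment> \<open>\<open>?u\<close> lies over the first two components and \<open>v\<close> over
    the third, so the two pushouts involving index 3 are those that compare \<open>?u\<close> with
    \<open>v\<close>.\<close>
  have "p 1 3 \<cdot> (r 1 \<cdot> ?u) = q 1 3 \<cdot> (r 3 \<cdot> v)"
    unfolding ru using comp_extend[OF eqs(2), of "c \<cdot> d"] p13 bs cA dA by simp
  then have xz: "related_comp X x z ?u v"
    by (rule exact_pushout_related_comp[OF exact r1 r3 x xrel z zrel po13 uv])
  have "p 2 3 \<cdot> (r 2 \<cdot> ?u) = q 2 3 \<cdot> (r 3 \<cdot> v)"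
    unfolding ru using comp_extend[OF eqs(3), of "c \<cdot> d"] p23 bs cA dA by simp
  then have yz: "related_comp X y z ?u v"
    by (rule exact_pushout_related_comp[OF exact r2 r3 y yrel z zrel po23 uv])
  obtain T3 e w where e: "cover e T3 (Dom C ?u)"
    and w: "related X x (?u \<cdot> e) w" "related X y (?u \<cdot> e) w" "related X z w (v \<cdot> e)"
    by (rule distributive_related_comp[OF dist xe ye ze xz yz])
  have e': "cover e T3 T2"
    using e t(1) dA by simp
  note eA = coverD[OF e']
  have wA: "w \<in> Hom C T3 X" "r 1 \<cdot> w = r 1 \<cdot> (?u \<cdot> e)" "r 2 \<cdot> w = r 2 \<cdot> (?u \<cdot> e)" "r 3 \<cdot> w = r 3 \<cdot> (v \<cdot> e)"
    using w v eA unfolding xrel yrel zrel parallel_def by auto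
  have uA: "?u \<in> Arr C" "Dom C ?u = T2" "Cod C ?u = X"
    using t(1) dA by simp_all
  have "r 1 \<cdot> w = b 1 \<cdot> (c \<cdot> (d \<cdot> e))"
    unfolding wA using comp_extend[OF ru(1) eA(2) uA(1)] uA eA r1 bs cA dA by simp
  moreover have "r 2 \<cdot> w = b 2 \<cdot> (c \<cdot> (d \<cdot> e))"
    unfolding wA using comp_extend[OF ru(2) eA(2) uA(1)] uA eA r2 bs cA dA by simp
  moreover have "r 3 \<cdot> w = b 3 \<cdot> (c \<cdot> (d \<cdot> e))"
    unfolding wA using comp_extend[OF ru(3) eA(2) v(1)] v(2,3) eA r3 bs cA dA by simp
  ultimately have "\<forall>i\<in>{1..3}. r i \<cdot> w = b i \<cdot> (c \<cdot> (d \<cdot> e))"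
    unfolding ball_one_to_three by blast
  then show ?thesis
    using cover_comp[OF c cover_comp[OF d e']] wA(1) by blast
qed

lemma exact_distributive_pushout_triples:
  assumes exact: "exact_category C" and dist: "\<forall>X\<in>Obj C. distributive_lattice (Equiv C X)"
  shows "pushout_triples_regular C"
  unfolding pushout_triples_regular_def
proof (intro ballI allI impI conjI)
  fix X and r :: "nat \<Rightarrow> 'a" and i j :: nat
  assume r: "\<forall>i\<in>{1..3}. regular_epi C (r i) \<and> Dom C (r i) = X" and ij: "i \<in> {1..3}" "j \<in> {1..3}"
  have ri: "regular_epi C (r i)" "Dom C (r i) = X" and rj: "regular_epi C (r j)" "Dom C (r j) = X"
    using r ij by blast+
  obtain m where m: "internal_relation C X m" "\<And>u v. related X m u v \<longleftrightarrow> parallel X u v \<and> r i \<cdot> u = r i \<cdot> v"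
    by (rule kernel_relation_exists[OF regular_epi_Arr[OF ri(1)] ri(2)]) (rule that)
  obtain n where n: "internal_relation C X n" "\<And>u v. related X n u v \<longleftrightarrow> parallel X u v \<and> r j \<cdot> u = r j \<cdot> v"
    by (rule kernel_relation_exists[OF regular_epi_Arr[OF rj(1)] rj(2)]) (rule that)
  show "\<exists>p q. is_pushout C (r i) (r j) p q"
    by (rule exact_pushout_exists[OF exact ri rj m n]) (intro exI)
next
  fix X and r :: "nat \<Rightarrow> 'a" and p q L \<pi> a
  assume X: "X \<in> Obj C" and r: "\<forall>i\<in>{1..3}. regular_epi C (r i) \<and> Dom C (r i) = X"
    and "(\<forall>i\<in>{1..3}. \<forall>j\<in>{1..3}. i < j \<longrightarrow> is_pushout C (r i) (r j) (p i j) (q i j)) \<and>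
       is_limit C (pushouts_diagram C r p q) L \<pi> \<and>
       a \<in> Hom C X L \<and> (\<forall>i\<in>{1..3}. \<pi> (VB i) \<cdot> a = r i)"
  then have po: "\<forall>i\<in>{1..3}. \<forall>j\<in>{1..3}. i < j \<longrightarrow> is_pushout C (r i) (r j) (p i j) (q i j)"
    and L: "is_limit C (pushouts_diagram C r p q) L \<pi>"
    and a: "a \<in> Hom C X L" "\<forall>i\<in>{1..3}. \<pi> (VB i) \<cdot> a = r i"
    by blast+
  have distX: "distributive_lattice (Equiv C X)"
    using dist X by blast
  show "regular_epi C a"
    by (rule regular_epi_into_limit[OF po L a]) (rule exact_triple_lift[OF exact distX r po])
qed

end

theorem theoremA:
  fixes C :: "('o, 'a) cat_data"
  assumes "regular_category C"
  shows "exact_arithmetical_category C \<longleftrightarrow>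
    (\<forall>X\<in>Obj C. \<forall>r :: nat \<Rightarrow> 'a.
      (\<forall>i\<in>{1..3}. regular_epi C (r i) \<and> Dom C (r i) = X) \<longrightarrow>
        (\<forall>i\<in>{1..3}. \<forall>j\<in>{1..3}. i < j \<longrightarrow> (\<exists>p q. is_pushout C (r i) (r j) p q)) \<and>
        (\<forall>p q L \<pi> a.
          (\<forall>i\<in>{1..3}. \<forall>j\<in>{1..3}. i < j \<longrightarrow> is_pushout C (r i) (r j) (p i j) (q i j)) \<and>
          is_limit C (pushouts_diagram C r p q) L \<pi> \<and>
          a \<in> Hom C X L \<and> (\<forall>i\<in>{1..3}. \<pi> (VB i) \<cdot>\<^bsub>C\<^esub> a = r i) \<longrightarrow>
          regular_epi C a))"
  unfolding pushout_triples_regular_def[symmetric]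
proof
  interpret category C
    using assms unfolding regular_category_def finitely_complete_def by blast
  interpret regular_cat C
    by unfold_locales (rule assms)
  show "pushout_triples_regular C" if ar: "exact_arithmetical_category C"
  proof -
    interpret regular_maltsev_cat C
      using ar unfolding exact_arithmetical_category_def by unfold_locales blast
    show ?thesis
      using exact_distributive_pushout_triples ar unfolding exact_arithmetical_category_def by blast
  qed
  show "exact_arithmetical_category C" if cond: "pushout_triples_regular C"
  proof -
    note em = pushout_triples_exact_maltsev[OF cond]
    \<comment> \<open>The Mal'tsev property, just derived from the condition, opens the description
      of joins as composites on which the proof of distributivity rests.\<close>
    interpret regular_maltsev_cat C
      by unfold_locales (rule em)
    show ?thesis
      using em pushout_triples_distributive[OF cond] unfolding exact_arithmetical_category_def by blast
  qed
qed

end
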